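(* Let $\rho\in[-1,1]$, and let $(X_i,Y_i)_{i\ge 1}$ be i.i.d. pairs with $X_i\sim\mathcal N(0,1)$ and $Y_i=\rho X_i+\sqrt{1-\rho^2}\,Z_i$, where $Z_i\sim\mathcal N(0,1)$ is independent of $X_i$. For $k>0$ let $t=Q^{-1}(h_g^{-1}(k))$, let $J=\min\{i: X_i>t\}$, and let $$\hat\rho_{\mathrm{th}}=\frac{Y_J}{\mathbb E X_J}.$$ Then $\hat\rho_{\mathrm{th}}$ is unbiased, i.e. $\mathbb E\hat\rho_{\mathrm{th}}=\rho$, and $$\operatorname{Var}\hat\rho_{\mathrm{th}}=\frac1k\left(\frac{1-\rho^2}{2\ln2}+o(1)\right),\qquad k\to\infty,$$ where $k$ is the expected number of transmitted bits. Furthermore, for $|\rho|<1$, $\hat\rho_{\mathrm{th}}$ is asymptotically efficient given $(X_J,Y_J)$.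
   Context: Notation: $Q(x)=\int_x^\infty \frac{1}{\sqrt{2\pi}}e^{-u^2/2}\,du$. For $p\in(0,1)$, $h(p)=-p\log_2p-(1-p)\log_2(1-p)$ and $h_g(p)=h(p)/p$, the entropy in bits of a geometric random variable with parameter $p$; $h_g$ is strictly decreasing from $(0,1)$ onto $(0,\infty)$ and $h_g^{-1}$ is its inverse. The index $J$ is geometric with parameter $Q(t)$; the expected number of bits needed to describe it is taken to be its entropy $h_g(Q(t))=k$ (the excess of at most one bit of an optimal prefix-free code is neglected by convention). Fisher information: for a statistic $T$ with density $f(t\mid\rho)$, $\mathrm I_T(\rho)=\mathbb E\big[(\partial_\rho\log f(T\mid\rho))^2\big]$ with natural logarithm. An estimator $\hat\rho$ (depending on $k$) is called asymptotically efficient given $T$ (also depending on $k$) if $\mathbb E\hat\rho\to\rho$ and $\mathrm I_T(\rho)\cdot\operatorname{Var}\hat\rho\to1$ as $k\to\infty$. The $o(1)$ term is for fixed $\rho$ as $k\to\infty$. *)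

theory Defs
  imports "HOL-Probability.Probability"
begin

definition Q :: "real \<Rightarrow> real" where
  "Q x = (LINT u:{x..}|lborel. 1 / sqrt (2 * pi) * exp (- u\<^sup>2 / 2))"

definition binary_entropy :: "real \<Rightarrow> real" where
  "binary_entropy p = - p * log 2 p - (1 - p) * log 2 (1 - p)"

definition geometric_entropy :: "real \<Rightarrow> real" where
  "geometric_entropy p = binary_entropy p / p"

text \<open>Both inverses are genuine: \<^term>\<open>Q\<close> is a bijection from the reals onto the open unit
  interval, and \<^term>\<open>geometric_entropy\<close> is a bijection from the open unit interval onto the
  positive reals. Hence the threshold is meaningful exactly for positive arguments.\<close>

definition threshold :: "real \<Rightarrow> real" where
  "threshold k = inv Q (inv_into {0<..<1} geometric_entropy k)"

definition noisy_copy ::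
    "(nat \<Rightarrow> 'a \<Rightarrow> real) \<Rightarrow> (nat \<Rightarrow> 'a \<Rightarrow> real) \<Rightarrow> real \<Rightarrow> nat \<Rightarrow> 'a \<Rightarrow> real" where
  "noisy_copy X Z r i \<omega> = r * X i \<omega> + sqrt (1 - r\<^sup>2) * Z i \<omega>"

text \<open>Indices start at 1. On the null event that the threshold is never exceeded the minimum does
  not exist; there the index is set to 1, because \<open>X 0\<close> is not part of the data and need
  not even be measurable.\<close>

definition first_exceedance :: "(nat \<Rightarrow> 'a \<Rightarrow> real) \<Rightarrow> real \<Rightarrow> 'a \<Rightarrow> nat" where
  "first_exceedance X t \<omega> =
     (if \<exists>i\<ge>1. X i \<omega> > t then LEAST i. 1 \<le> i \<and> X i \<omega> > t else 1)"

definition at_index :: "(nat \<Rightarrow> 'a \<Rightarrow> 'b) \<Rightarrow> ('a \<Rightarrow> nat) \<Rightarrow> 'a \<Rightarrow> 'b" where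
  "at_index V J \<omega> = V (J \<omega>) \<omega>"

definition threshold_estimator ::
    "'a measure \<Rightarrow> (nat \<Rightarrow> 'a \<Rightarrow> real) \<Rightarrow> (nat \<Rightarrow> 'a \<Rightarrow> real) \<Rightarrow> real \<Rightarrow> 'a \<Rightarrow> real" where
  "threshold_estimator M X Y k \<omega> =
     (let J = first_exceedance X (threshold k)
      in at_index Y J \<omega> / prob_space.expectation M (at_index X J))"

text \<open>\<open>T r\<close> is the statistic when the parameter has value \<open>r\<close>, and \<open>\<Theta>\<close> is the (open) parameter set.
  A density is only determined almost everywhere, separately for each parameter value, so a
  derivative in the parameter is meaningful only for a version of the densities that is
  differentiable in the parameter. Any two such versions give the same Fisher information; see
  \<open>has_fisher_information_unique\<close> below.\<close>

definition smooth_densities ::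
    "'a measure \<Rightarrow> 'b measure \<Rightarrow> real set \<Rightarrow> (real \<Rightarrow> 'a \<Rightarrow> 'b) \<Rightarrow> (real \<Rightarrow> 'b \<Rightarrow> real) \<Rightarrow> bool" where
  "smooth_densities M N \<Theta> T f \<longleftrightarrow>
     (\<forall>r\<in>\<Theta>. distributed M N (T r) (\<lambda>x. ennreal (f r x)) \<and> (\<forall>x. 0 \<le> f r x)) \<and>
     (\<forall>x. (\<lambda>r. f r x) differentiable_on \<Theta>)"

text \<open>The expectation of the squared score is written as an integral against the density, so that
  points of density zero, where the logarithm is not meaningful, do not contribute.\<close>

definition has_fisher_information ::
    "'a measure \<Rightarrow> 'b measure \<Rightarrow> real set \<Rightarrow> (real \<Rightarrow> 'a \<Rightarrow> 'b) \<Rightarrow> real \<Rightarrow> real \<Rightarrow> bool" where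
  "has_fisher_information M N \<Theta> T \<rho> I \<longleftrightarrow>
     (\<exists>f. smooth_densities M N \<Theta> T f \<and>
        has_bochner_integral N (\<lambda>x. f \<rho> x * (deriv (\<lambda>r. ln (f r x)) \<rho>)\<^sup>2) I)"

lemma has_fisher_information_unique:
  assumes N: "sigma_finite_measure N" and op: "open \<Theta>" and \<rho>: "\<rho> \<in> \<Theta>"
    and I: "has_fisher_information M N \<Theta> T \<rho> I"
    and I': "has_fisher_information M N \<Theta> T \<rho> I'"
  shows "I = I'"
proof -
  interpret N: sigma_finite_measure N by fact
  obtain f where f: "smooth_densities M N \<Theta> T f"
    and fI: "has_bochner_integral N (\<lambda>x. f \<rho> x * (deriv (\<lambda>r. ln (f r x)) \<rho>)\<^sup>2) I"
    using I unfolding has_fisher_information_def by blast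
  obtain g where g: "smooth_densities M N \<Theta> T g"
    and gI: "has_bochner_integral N (\<lambda>x. g \<rho> x * (deriv (\<lambda>r. ln (g r x)) \<rho>)\<^sup>2) I'"
    using I' unfolding has_fisher_information_def by blast
  have rat: "AE x in N. f r x = g r x" if r: "r \<in> \<Theta>" for r
  proof -
    have "AE x in N. ennreal (f r x) = ennreal (g r x)"
      using f g r unfolding smooth_densities_def distributed_def
      by (intro N.density_unique) (auto simp del: ennreal_inj)
    then show ?thesis
      using f g r unfolding smooth_densities_def by simp
  qed
  have "AE x in N. \<forall>r\<in>\<Theta> \<inter> \<rat>. f r x = g r x"
    using rat by (subst AE_ball_countable) (auto intro: countable_Int2 countable_rat)
  then have "AE x in N. f \<rho> x * (deriv (\<lambda>r. ln (f r x)) \<rho>)\<^sup>2 =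
      g \<rho> x * (deriv (\<lambda>r. ln (g r x)) \<rho>)\<^sup>2"
  proof (rule AE_mp, intro AE_I2 impI)
    fix x assume eq: "\<forall>r\<in>\<Theta> \<inter> \<rat>. f r x = g r x"
    have cont: "continuous_on \<Theta> (\<lambda>r. f r x - g r x)"
      using f g unfolding smooth_densities_def
      by (intro continuous_on_diff differentiable_imp_continuous_on) auto
    have all: "f r x = g r x" if r: "r \<in> \<Theta>" for r
    proof (rule ccontr)
      assume ne: "f r x \<noteq> g r x"
      have "open (\<Theta> \<inter> (\<lambda>r. f r x - g r x) -` (- {0}))"
        by (rule continuous_open_preimage[OF cont op]) auto
      moreover have "r \<in> \<Theta> \<inter> (\<lambda>r. f r x - g r x) -` (- {0})"
        using r ne by auto
      ultimately obtain e where "e > 0"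
        and e: "ball r e \<subseteq> \<Theta> \<inter> (\<lambda>r. f r x - g r x) -` (- {0})"
        using open_contains_ball by blast
      obtain q where "q \<in> \<rat>" "r < q" "q < r + e"
        using Rats_dense_in_real[of r "r + e"] \<open>e > 0\<close> by auto
      then have "q \<in> ball r e" by (auto simp: dist_real_def)
      then have "q \<in> \<Theta>" "f q x - g q x \<noteq> 0" using e by blast+
      then show False using eq \<open>q \<in> \<rat>\<close> by auto
    qed
    have "eventually (\<lambda>r. ln (f r x) = ln (g r x)) (nhds \<rho>)"
      using eventually_nhds_in_open[OF op \<rho>] by eventually_elim (simp add: all)
    then have "deriv (\<lambda>r. ln (f r x)) \<rho> = deriv (\<lambda>r. ln (g r x)) \<rho>"
      by (intro deriv_cong_ev) auto
    then show "f \<rho> x * (deriv (\<lambda>r. ln (f r x)) \<rho>)\<^sup>2 = g \<rho> x * (deriv (\<lambda>r. ln (g r x)) \<rho>)\<^sup>2"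
      using all[OF \<rho>] by simp
  qed
  then have "has_bochner_integral N (\<lambda>x. g \<rho> x * (deriv (\<lambda>r. ln (g r x)) \<rho>)\<^sup>2) I"
    using fI gI by (subst has_bochner_integral_cong_AE[symmetric])
      (auto dest: borel_measurable_has_bochner_integral)
  then show ?thesis
    using gI has_bochner_integral_eq by blast
qed

text \<open>\<open>est k\<close> is the estimator at rate \<open>k\<close> (under the true parameter \<open>\<rho>\<close>), and \<open>T k r\<close> the statistic
  at rate \<open>k\<close> under the parameter value \<open>r\<close>.\<close>

definition asymptotically_efficient ::
    "'a measure \<Rightarrow> 'b measure \<Rightarrow> real set \<Rightarrow> (real \<Rightarrow> real \<Rightarrow> 'a \<Rightarrow> 'b) \<Rightarrow> (real \<Rightarrow> 'a \<Rightarrow> real) \<Rightarrow>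
      real \<Rightarrow> bool" where
  "asymptotically_efficient M N \<Theta> T est \<rho> \<longleftrightarrow>
     ((\<lambda>k. prob_space.expectation M (est k)) \<longlongrightarrow> \<rho>) at_top \<and>
     (\<exists>I. (\<forall>k>0. has_fisher_information M N \<Theta> (T k) \<rho> (I k)) \<and>
          ((\<lambda>k. I k * prob_space.variance M (est k)) \<longlongrightarrow> 1) at_top)"

end

theory Submission
  imports Defs "HOL-Real_Asymp.Real_Asymp"
begin

text \<open>
  Up to the first time \<open>n\<close> at which an i.i.d. sequence \<open>W\<close> enters a set \<open>B\<close> of probability \<open>p > 0\<close>,
  the event \<open>W\<^sub>n \<in> A\<close> contributes \<open>(1 - p)\<^sup>n\<^sup>-\<^sup>1 P(W\<^sub>1 \<in> A \<inter> B)\<close>. Hence the entry time is geometric and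
  \<open>W\<^sub>J\<close> has the law of \<open>W\<^sub>1\<close> conditioned on \<open>B\<close>. With \<open>W\<^sub>i = (X\<^sub>i, Y\<^sub>i)\<close> and \<open>B = {X > t}\<close>, all moments
  reduce to truncated Gaussian moments of \<open>X\<^sub>1\<close> times Gaussian moments of \<open>Z\<^sub>1\<close>. Writing
  \<open>m = \<phi>(t) / Q(t) = E X\<^sub>J\<close> and \<open>v = 1 + t m - m\<^sup>2 = Var X\<^sub>J\<close>, this gives
  \<open>Var = (1 - \<rho>\<^sup>2 + \<rho>\<^sup>2 v) / m\<^sup>2\<close> and Fisher information
  \<open>2\<rho>\<^sup>2 / (1 - \<rho>\<^sup>2)\<^sup>2 + (1 + t m) / (1 - \<rho>\<^sup>2)\<close>. The bounds
  \<open>\<phi>(t) (1/t - 1/t\<^sup>3) \<le> Q(t) \<le> \<phi>(t) (1/t - 1/t\<^sup>3 + 3/t\<^sup>5)\<close> yield \<open>v \<rightarrow> 0\<close> and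
  \<open>h\<^sub>g(Q(t)) / m\<^sup>2 \<rightarrow> 1 / (2 ln 2)\<close>.
\<close>

section \<open>The Gaussian tail\<close>

text \<open>\<open>Q\<close> integrates over the closed ray, while selection is by strict
  exceedance; the two rays differ by one null point.\<close>

lemma normal_tail_integral:
  "has_bochner_integral lborel (\<lambda>u. std_normal_density u * indicator {t<..} u) (Q t)"
proof -
  have "integrable lborel (\<lambda>u. std_normal_density u * indicator {t<..} u)"
    by (rule integrable_real_mult_indicator) auto
  moreover have "Q t = (\<integral>u. std_normal_density u * indicator {t<..} u \<partial>lborel)"
    unfolding Q_def set_lebesgue_integral_def
    by (rule integral_cong_AE, measurable, rule AE_I[of _ _ "{t}"])
       (auto simp: std_normal_density_def split: split_indicator)
  ultimately show ?thesis
    by (metis has_bochner_integral_integrable)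
qed

lemma normal_tail_emeasure:
  "(\<integral>\<^sup>+u. ennreal (std_normal_density u) * indicator {t<..} u \<partial>lborel) = ennreal (Q t)"
proof -
  have "(\<integral>\<^sup>+u. ennreal (std_normal_density u) * indicator {t<..} u \<partial>lborel) =
      (\<integral>\<^sup>+u. ennreal (std_normal_density u * indicator {t<..} u) \<partial>lborel)"
    by (intro nn_integral_cong) (auto split: split_indicator)
  also have "\<dots> = ennreal (Q t)"
    using normal_tail_integral[of t]
    by (subst nn_integral_eq_integral) (auto simp: has_bochner_integral_iff)
  finally show ?thesis .
qed

lemma Q_nonneg: "0 \<le> Q t"
proof -
  have "0 \<le> (\<integral>u. std_normal_density u * indicator {t<..} u \<partial>lborel)"
    by (intro Bochner_Integration.integral_nonneg) auto
  then show ?thesis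
    using has_bochner_integral_integral_eq[OF normal_tail_integral[of t]] by simp
qed

text \<open>Through the normal distribution function, monotonicity, continuity and the limits of
  \<open>Q\<close> become general facts about distribution functions.\<close>

lemma Q_eq_cdf: "Q t = 1 - cdf std_normal_distribution t"
proof -
  interpret real_distribution std_normal_distribution by (rule real_dist_normal_dist)
  have "Q t = measure std_normal_distribution {t<..}"
    by (simp add: measure_def emeasure_density normal_tail_emeasure Q_nonneg)
  also have "\<dots> = measure std_normal_distribution (space std_normal_distribution - {..t})"
    by (intro arg_cong[where f="measure _"]) auto
  also have "\<dots> = 1 - cdf std_normal_distribution t"
    unfolding cdf_def by (rule prob_compl) auto
  finally show ?thesis .
qed

lemma continuous_Q: "isCont Q t"
proof -
  interpret real_distribution std_normal_distribution by (rule real_dist_normal_dist)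
  have "emeasure std_normal_distribution {t} = 0"
    by (subst emeasure_density) (auto simp: nn_integral_0_iff_AE AE_lborel_singleton
        intro!: AE_I[of _ _ "{t}"] split: split_indicator)
  then have "isCont (cdf std_normal_distribution) t"
    by (simp add: isCont_cdf measure_def)
  then show ?thesis
    unfolding Q_eq_cdf[abs_def] by (intro continuous_intros)
qed

lemma Q_antimono: "s \<le> t \<Longrightarrow> Q t \<le> Q s"
  using finite_borel_measure.cdf_nondecreasing
    [OF real_distribution.finite_borel_measure_M[OF real_dist_normal_dist]]
  by (simp add: Q_eq_cdf)

lemma Q_at_top: "(Q \<longlongrightarrow> 0) at_top"
proof -
  have "(Q \<longlongrightarrow> 1 - 1) at_top" unfolding Q_eq_cdf[abs_def]
    by (intro tendsto_intros real_distribution.cdf_lim_at_top_prob[OF real_dist_normal_dist])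
  then show ?thesis by simp
qed

lemma Q_at_bot: "(Q \<longlongrightarrow> 1) at_bot"
proof -
  have "(Q \<longlongrightarrow> 1 - 0) at_bot" unfolding Q_eq_cdf[abs_def]
    by (intro tendsto_intros finite_borel_measure.cdf_lim_at_bot
      real_distribution.finite_borel_measure_M real_dist_normal_dist)
  then show ?thesis by simp
qed

text \<open>Intermediate values between the limits 1 and 0 of \<open>Q\<close>. Surjectivity makes
  \<open>inv Q\<close> a right inverse on the open unit interval, which is how
  \<open>threshold\<close> is evaluated.\<close>

lemma Q_surj: assumes "0 < p" "p < 1" shows "p \<in> range Q"
proof -
  \<comment> \<open>The conjunct \<open>0 \<le> t\<close> here and \<open>t \<le> 0\<close> below
    put the two witnesses in the order that \<open>IVT2\<close> requires.\<close>
  have "eventually (\<lambda>t. Q t < p \<and> 0 \<le> t) at_top"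
    using order_tendstoD(2)[OF Q_at_top \<open>0 < p\<close>] eventually_ge_at_top[of 0] by eventually_elim auto
  then obtain b where b: "Q b < p" "0 \<le> b"
    by (metis (mono_tags, lifting) eventually_at_top_linorder order_refl)
  have "eventually (\<lambda>t. p < Q t \<and> t \<le> 0) at_bot"
    using order_tendstoD(1)[OF Q_at_bot \<open>p < 1\<close>] eventually_le_at_bot[of 0] by eventually_elim auto
  then obtain a where a: "p < Q a" "a \<le> 0"
    by (metis (mono_tags, lifting) eventually_at_bot_linorder order_refl)
  obtain t where "Q t = p"
    using IVT2[of Q b p a] a b continuous_Q by fastforce
  then show ?thesis by blast
qed

section \<open>Truncated moments of the standard normal law\<close>

lemma std_normal_density_deriv:
  "(std_normal_density has_real_derivative - x * std_normal_density x) (at x)"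
  unfolding std_normal_density_def[abs_def]
  by (auto intro!: derivative_eq_intros simp: field_simps)

lemma std_normal_density_decay:
  "((\<lambda>x. std_normal_density x) \<longlongrightarrow> 0) at_top"
  "((\<lambda>x. x * std_normal_density x) \<longlongrightarrow> 0) at_top"
  unfolding std_normal_density_def by real_asymp+

text \<open>Reduces a truncated moment to naming an antiderivative that vanishes at infinity. The
  density stays the leading factor because \<open>moment_product\<close> takes its one-dimensional
  integrals in that shape.\<close>

lemma normal_tail_FTC:
  fixes F f :: "real \<Rightarrow> real"
  assumes F: "\<And>x. (F has_real_derivative std_normal_density x * f x) (at x)"
    and f: "\<And>x. isCont f x" and int: "integrable lborel (\<lambda>x. std_normal_density x * f x)"
    and lim: "(F \<longlongrightarrow> 0) at_top"
  shows "has_bochner_integral lborel (\<lambda>u. std_normal_density u * (indicator {t<..} u * f u)) (- F t)"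
proof -
  have "(LBINT x=ereal t..\<infinity>. std_normal_density x * f x) = 0 - F t"
  proof (rule interval_integral_FTC_integrable)
    show "(F has_vector_derivative std_normal_density x * f x) (at x)" for x
      using F by (simp add: has_real_derivative_iff_has_vector_derivative)
    show "isCont (\<lambda>x. std_normal_density x * f x) x" for x
      by (intro continuous_mult f DERIV_isCont[OF std_normal_density_deriv])
    show "set_integrable lborel (einterval (ereal t) \<infinity>) (\<lambda>x. std_normal_density x * f x)"
      unfolding set_integrable_def using int by (intro integrable_mult_indicator) auto
    have "isCont F t" using F DERIV_isCont by blast
    then have "(F \<longlongrightarrow> F t) (at_right t)"
      by (auto simp: isCont_def filterlim_at_split)
    then show "((F \<circ> real_of_ereal) \<longlongrightarrow> F t) (at_right (ereal t))"
      by (simp add: ereal_tendsto_simps)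
    show "((F \<circ> real_of_ereal) \<longlongrightarrow> 0) (at_left \<infinity>)"
      using lim by (simp add: ereal_tendsto_simps)
  qed simp
  then have "(\<integral>x. indicator {t<..} x *\<^sub>R (std_normal_density x * f x) \<partial>lborel) = - F t"
    by (simp add: interval_lebesgue_integral_def set_lebesgue_integral_def)
  moreover have "integrable lborel (\<lambda>x. indicator {t<..} x *\<^sub>R (std_normal_density x * f x))"
    using int by (intro integrable_mult_indicator) auto
  ultimately show ?thesis
    by (simp add: has_bochner_integral_iff mult_ac)
qed

lemma normal_tail_first_moment:
  "has_bochner_integral lborel (\<lambda>u. std_normal_density u * (indicator {t<..} u * u)) (std_normal_density t)"
proof -
  have "has_bochner_integral lborel (\<lambda>u. std_normal_density u * (indicator {t<..} u * u))
      (- (- std_normal_density t))"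
  proof (rule normal_tail_FTC)
    show "((\<lambda>x. - std_normal_density x) has_real_derivative std_normal_density x * x) (at x)" for x
      by (rule derivative_eq_intros std_normal_density_deriv)+ auto
    show "integrable lborel (\<lambda>x. std_normal_density x * x)"
      using integrable_std_normal_moment[of 1] by simp
    show "((\<lambda>x. - std_normal_density x) \<longlongrightarrow> 0) at_top"
      using tendsto_minus[OF std_normal_density_decay(1)] by simp
  qed auto
  then show ?thesis by simp
qed

text \<open>The antiderivative \<open>- (x * std_normal_density x)\<close> belongs to the polynomial
  \<open>x^2 - 1\<close>, not to \<open>x^2\<close>; the missing 1 contributes the tail mass
  \<open>Q t\<close>.\<close>

lemma normal_tail_second_moment:
  "has_bochner_integral lborel (\<lambda>u. std_normal_density u * (indicator {t<..} u * u\<^sup>2))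
     (t * std_normal_density t + Q t)"
proof -
  have "has_bochner_integral lborel (\<lambda>u. std_normal_density u * (indicator {t<..} u * (u\<^sup>2 - 1)))
      (- (- (t * std_normal_density t)))"
  proof (rule normal_tail_FTC)
    show "((\<lambda>x. - (x * std_normal_density x)) has_real_derivative
        std_normal_density x * (x\<^sup>2 - 1)) (at x)" for x
      by (rule DERIV_cong, (rule derivative_intros std_normal_density_deriv)+)
        (simp add: algebra_simps power2_eq_square)
    show "integrable lborel (\<lambda>x. std_normal_density x * (x\<^sup>2 - 1))"
      using Bochner_Integration.integrable_diff[OF integrable_std_normal_moment[of 2]
        integrable_std_normal_moment[of 0]] by (simp add: algebra_simps)
    show "((\<lambda>x. - (x * std_normal_density x)) \<longlongrightarrow> 0) at_top"
      using tendsto_minus[OF std_normal_density_decay(2)] by simp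
  qed (auto intro!: continuous_intros)
  from has_bochner_integral_add[OF this normal_tail_integral[of t]]
  show ?thesis by (simp add: algebra_simps)
qed

section \<open>Mills ratio, hazard rate and variance of the truncated normal law\<close>

lemma Mills_bounds:
  assumes t: "t \<ge> 2"
  shows "std_normal_density t * (1/t - 1/t^3) \<le> Q t"
    and "Q t \<le> std_normal_density t * (1/t - 1/t^3 + 3/t^5)"
proof -
  have Q: "(\<integral>\<^sup>+u. ennreal (std_normal_density u) * indicator {t..} u \<partial>lborel) = ennreal (Q t)"
    unfolding normal_tail_emeasure[symmetric]
    by (rule nn_integral_cong_AE, rule AE_I[of _ _ "{t}"]) (auto split: split_indicator)
  have dpos: "std_normal_density x > 0" for x by (simp add: std_normal_density_def)
  \<comment> \<open>Applied with \<open>G\<close> a truncation of the asymptotic series of the Mills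
    ratio \<open>Q / std_normal_density\<close>. Then \<open>x * G x - D\<close> collapses to 1 plus
    one remainder of fixed sign, \<open>- 3/x^4\<close> for the lower and \<open>15/x^6\<close> for
    the upper bound, and comparison with the density under the integral over \<open>{t..}\<close>
    gives both inequalities.\<close>
  have deriv: "((\<lambda>x. - (std_normal_density x * G x)) has_real_derivative
      std_normal_density x * (x * G x - D)) (at x)"
    if "(G has_real_derivative D) (at x)" for G D x
    by (rule DERIV_cong, (rule derivative_intros std_normal_density_deriv that)+)
      (simp add: algebra_simps)
  let ?f = "\<lambda>x. std_normal_density x * (1 - 3/x^4)"
  let ?g = "\<lambda>x. std_normal_density x * (1 + 15/x^6)"
  have "ennreal (std_normal_density t * (1/t - 1/t^3)) = (\<integral>\<^sup>+u. ennreal (?f u) * indicator {t..} u \<partial>lborel)"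
  proof (subst nn_integral_FTC_atLeast)
    show "((\<lambda>x. - (std_normal_density x * (1/x - 1/x^3))) has_real_derivative ?f x) (at x)"
      if "t \<le> x" for x
    proof (rule DERIV_cong[OF deriv])
      show "((\<lambda>x. 1/x - 1/x^3) has_real_derivative - 1/x^2 + 3/x^4) (at x)"
        using that t by (auto intro!: derivative_eq_intros simp: field_simps eval_nat_numeral)
      show "std_normal_density x * (x * (1/x - 1/x^3) - (- 1/x^2 + 3/x^4)) = ?f x"
        using that t by (simp add: field_simps eval_nat_numeral)
    qed
    show "0 \<le> ?f x" if "t \<le> x" for x
    proof -
      \<comment> \<open>The integral is a nonnegative one, so \<open>1 - 3/x^4\<close> must not be
        negative; \<open>t \<ge> 2\<close> guarantees this.\<close>
      have "2^4 \<le> x^4" using t that by (intro power_mono) auto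
      then show ?thesis using dpos[of x] by (intro mult_nonneg_nonneg) (auto simp: divide_le_eq_1)
    qed
    show "((\<lambda>x. - (std_normal_density x * (1/x - 1/x^3))) \<longlongrightarrow> 0) at_top"
      unfolding std_normal_density_def by real_asymp
  qed auto
  also have "\<dots> \<le> ennreal (Q t)"
    unfolding Q[symmetric] using dpos
    by (intro nn_integral_mono) (auto intro!: ennreal_leI mult_left_le split: split_indicator)
  finally show "std_normal_density t * (1/t - 1/t^3) \<le> Q t"
    using Q_nonneg by simp
  have "ennreal (Q t) \<le> (\<integral>\<^sup>+u. ennreal (?g u) * indicator {t..} u \<partial>lborel)"
    unfolding Q[symmetric] using dpos
    by (intro nn_integral_mono)
      (auto intro!: ennreal_leI simp: distrib_left split: split_indicator)
  also have "\<dots> = ennreal (std_normal_density t * (1/t - 1/t^3 + 3/t^5))"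
  proof (subst nn_integral_FTC_atLeast)
    show "((\<lambda>x. - (std_normal_density x * (1/x - 1/x^3 + 3/x^5))) has_real_derivative ?g x) (at x)"
      if "t \<le> x" for x
    proof (rule DERIV_cong[OF deriv])
      show "((\<lambda>x. 1/x - 1/x^3 + 3/x^5) has_real_derivative - 1/x^2 + 3/x^4 - 15/x^6) (at x)"
        using that t by (auto intro!: derivative_eq_intros simp: field_simps eval_nat_numeral)
      show "std_normal_density x * (x * (1/x - 1/x^3 + 3/x^5) - (- 1/x^2 + 3/x^4 - 15/x^6)) = ?g x"
        using that t by (simp add: field_simps eval_nat_numeral)
    qed
    show "0 \<le> ?g x" if "t \<le> x" for x
      using dpos[of x] by (intro mult_nonneg_nonneg) auto
    show "((\<lambda>x. - (std_normal_density x * (1/x - 1/x^3 + 3/x^5))) \<longlongrightarrow> 0) at_top"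
      unfolding std_normal_density_def by real_asymp
  qed auto
  finally have "ennreal (Q t) \<le> ennreal (std_normal_density t * (1/t - 1/t^3 + 3/t^5))" .
  moreover have "0 \<le> 1/t - 1/t^3 + 3/t^5"
  proof -
    have "1/t^3 \<le> 1/t^1" using t by (intro divide_left_mono power_increasing) auto
    moreover have "0 \<le> 3/t^5" using t by simp
    ultimately show ?thesis by simp
  qed
  ultimately show "Q t \<le> std_normal_density t * (1/t - 1/t^3 + 3/t^5)"
    using dpos[of t] by (subst (asm) ennreal_le_iff) auto
qed

lemma Q_pos: "0 < Q t"
proof -
  \<comment> \<open>The lower Mills bound is available from 2 on; \<open>Q_antimono\<close> carries
    positivity back to smaller \<open>t\<close>.\<close>
  let ?s = "max t 2"
  have "?s ^ 1 < ?s ^ 3" by (intro power_strict_increasing) auto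
  then have "0 < std_normal_density ?s * (1/?s - 1/?s^3)"
    by (intro mult_pos_pos normal_density_pos) (auto simp: divide_strict_left_mono)
  also have "\<dots> \<le> Q ?s" by (rule Mills_bounds) auto
  also have "\<dots> \<le> Q t" by (rule Q_antimono) auto
  finally show ?thesis .
qed

text \<open>The hazard rate (inverse Mills ratio) of the standard normal law, which is also the mean
  of a standard normal variable conditioned on exceeding \<open>t\<close>.\<close>

definition hazard :: "real \<Rightarrow> real" where
  "hazard t = std_normal_density t / Q t"

lemma hazard_pos: "0 < hazard t"
  by (simp add: hazard_def Q_pos normal_density_pos)

text \<open>Reciprocals of the Mills bounds, so the upper bound on \<open>Q\<close> turns into the
  lower bound here and vice versa.\<close>

lemma hazard_bounds:
  assumes "t \<ge> 2"
  shows "t / (1 - 1/t^2 + 3/t^4) \<le> hazard t" "hazard t \<le> t / (1 - 1/t^2)"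
proof -
  have p: "std_normal_density t > 0" by (simp add: normal_density_pos)
  have t2: "1 < t^2" using assms by (simp add: one_less_power)
  have e1: "t / (1 - 1/t^2) = 1 / (1/t - 1/t^3)"
    using assms by (simp add: field_simps eval_nat_numeral)
  have "1/t - 1/t^3 + 3/t^5 = (1 - 1/t^2 + 3/t^4) / t"
    using assms by (simp add: field_simps eval_nat_numeral)
  then have e2: "t / (1 - 1/t^2 + 3/t^4) = 1 / (1/t - 1/t^3 + 3/t^5)"
    by simp
  have "0 < (1 - 1/t^2) / t" using assms t2 by simp
  also have "(1 - 1/t^2) / t = 1/t - 1/t^3"
    using assms by (simp add: field_simps eval_nat_numeral)
  finally have pos: "0 < 1/t - 1/t^3" .
  then have pos2: "0 < 1/t - 1/t^3 + 3/t^5"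
    using assms by (intro add_pos_nonneg) auto
  show "t / (1 - 1/t^2 + 3/t^4) \<le> hazard t"
    unfolding e2 hazard_def using Mills_bounds(2)[OF assms] p Q_pos[of t] pos2
    by (simp add: field_simps)
  show "hazard t \<le> t / (1 - 1/t^2)"
    unfolding e1 hazard_def using Mills_bounds(1)[OF assms] p Q_pos[of t] pos
    by (simp add: divide_le_eq le_divide_eq mult_ac)
qed

lemma hazard_asymp: "((\<lambda>t. hazard t / t) \<longlongrightarrow> 1) at_top"
proof (rule tendsto_sandwich)
  show "eventually (\<lambda>t. (t / (1 - 1/t^2 + 3/t^4)) / t \<le> hazard t / t) at_top"
    using eventually_ge_at_top[of 2]
    by eventually_elim (intro divide_right_mono hazard_bounds, auto)
  show "eventually (\<lambda>t. hazard t / t \<le> (t / (1 - 1/t^2)) / t) at_top"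
    using eventually_ge_at_top[of 2]
    by eventually_elim (intro divide_right_mono hazard_bounds, auto)
  show "((\<lambda>t::real. (t / (1 - 1/t^2 + 3/t^4)) / t) \<longlongrightarrow> 1) at_top" by real_asymp
  show "((\<lambda>t::real. (t / (1 - 1/t^2)) / t) \<longlongrightarrow> 1) at_top" by real_asymp
qed

lemma hazard_at_top: "filterlim hazard at_top at_top"
proof -
  have "filterlim (\<lambda>t. hazard t / t * t) at_top at_top"
    by (rule filterlim_tendsto_pos_mult_at_top[OF hazard_asymp])
      (auto simp: filterlim_ident)
  moreover have "eventually (\<lambda>t. hazard t / t * t = hazard t) at_top"
    using eventually_gt_at_top[of 0] by eventually_elim simp
  ultimately show ?thesis
    using filterlim_cong by fast
qed

text \<open>The variance of a standard normal variable conditioned on exceeding \<open>t\<close>: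
  the conditional second moment is \<open>1 + t * hazard t\<close>.\<close>

definition tail_variance :: "real \<Rightarrow> real" where
  "tail_variance t = 1 + t * hazard t - (hazard t)\<^sup>2"

text \<open>The quantity equals \<open>1 - hazard t * (hazard t - t)\<close>. Its second factor
  decays like \<open>1/t\<close>, so the first-order statement \<open>hazard_asymp\<close> cannot
  decide the limit; the finer \<open>hazard_bounds\<close> squeeze the product to 1.\<close>

lemma tail_variance_tendsto: "(tail_variance \<longlongrightarrow> 0) at_top"
proof -
  let ?l = "\<lambda>t::real. t / (1 - 1/t^2 + 3/t^4)" and ?u = "\<lambda>t::real. t / (1 - 1/t^2)"
  \<comment> \<open>For large \<open>t\<close> the lower bound on \<open>hazard t\<close> exceeds
    \<open>t\<close>; both factors are then nonnegative and the products can be compared factor by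
    factor.\<close>
  have ev: "eventually (\<lambda>t. 2 \<le> t \<and> t \<le> ?l t) at_top"
    by (intro eventually_conj eventually_ge_at_top) real_asymp
  have "((\<lambda>t. hazard t * (hazard t - t)) \<longlongrightarrow> 1) at_top"
  proof (rule tendsto_sandwich)
    show "eventually (\<lambda>t. ?l t * (?l t - t) \<le> hazard t * (hazard t - t)) at_top"
      using ev
    proof eventually_elim
      case (elim t)
      then show ?case
        using hazard_bounds(1)[of t] by (intro mult_mono) auto
    qed
    show "eventually (\<lambda>t. hazard t * (hazard t - t) \<le> ?u t * (?u t - t)) at_top"
      using ev
    proof eventually_elim
      case (elim t)
      then have "t \<le> hazard t" "hazard t \<le> ?u t"
        using hazard_bounds[of t] by auto
      then show ?case
        using elim by (intro mult_mono) auto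
    qed
    show "((\<lambda>t. ?l t * (?l t - t)) \<longlongrightarrow> 1) at_top" by real_asymp
    show "((\<lambda>t. ?u t * (?u t - t)) \<longlongrightarrow> 1) at_top" by real_asymp
  qed
  then have "((\<lambda>t. 1 - hazard t * (hazard t - t)) \<longlongrightarrow> 1 - 1) at_top"
    by (intro tendsto_intros)
  then show ?thesis
    by (simp add: tail_variance_def[abs_def] algebra_simps power2_eq_square)
qed

section \<open>Entropy of the geometric law and growth of the threshold\<close>

lemma geometric_entropy_eq:
  assumes "0 < p" "p < 1"
  shows "geometric_entropy p * ln 2 = - ln p + (- (1 - p) * ln (1 - p) / p)"
  using assms by (simp add: geometric_entropy_def binary_entropy_def log_def field_simps)

lemma Q_within_0: "filterlim Q (at_right 0) at_top"
  unfolding filterlim_at using Q_at_top Q_pos by (simp add: less_imp_neq[symmetric])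

text \<open>Since \<open>Q t = std_normal_density t / hazard t\<close>, the main entropy term
  \<open>- ln (Q t)\<close> is \<open>t^2 / 2\<close> plus \<open>ln (hazard t)\<close> plus a
  constant, and the rest of the entropy tends to 1. After division by \<open>(hazard t)^2\<close>,
  which grows like \<open>t^2\<close>, only the \<open>t^2 / 2\<close> survives; \<open>ln 2\<close>
  converts nats to bits.\<close>

lemma geometric_entropy_Q_asymp:
  "((\<lambda>t. geometric_entropy (Q t) / (hazard t)\<^sup>2) \<longlongrightarrow> 1 / (2 * ln 2)) at_top"
proof -
  let ?g = "\<lambda>p::real. - (1 - p) * ln (1 - p) / p"
  have "(?g \<longlongrightarrow> 1) (at_right 0)" by real_asymp
  then have g: "((\<lambda>t. ?g (Q t)) \<longlongrightarrow> 1) at_top"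
    by (rule filterlim_compose[OF _ Q_within_0])
  have h2: "filterlim (\<lambda>t. (hazard t)\<^sup>2) at_infinity at_top"
    by (rule filterlim_at_top_imp_at_infinity, rule filterlim_pow_at_top[OF _ hazard_at_top]) simp
  have t2: "((\<lambda>t. 1 / (2 * (hazard t / t)^2)) \<longlongrightarrow> 1 / (2 * 1^2)) at_top"
    by (intro tendsto_intros hazard_asymp) auto
  have "((\<lambda>x::real. ln x / x^2) \<longlongrightarrow> 0) at_top" by real_asymp
  then have l: "((\<lambda>t. ln (hazard t) / (hazard t)^2) \<longlongrightarrow> 0) at_top"
    by (rule filterlim_compose[OF _ hazard_at_top])
  have c: "((\<lambda>t. (ln (sqrt (2 * pi)) + ?g (Q t)) / (hazard t)\<^sup>2) \<longlongrightarrow> 0) at_top"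
    by (rule tendsto_divide_0[OF tendsto_add[OF tendsto_const g] h2])
  have "((\<lambda>t. (1 / (2 * (hazard t / t)^2) + ln (hazard t) / (hazard t)^2 +
      (ln (sqrt (2 * pi)) + ?g (Q t)) / (hazard t)\<^sup>2) / ln 2) \<longlongrightarrow> (1 / (2 * 1^2) + 0 + 0) / ln 2) at_top"
    by (intro tendsto_divide tendsto_add t2 l c tendsto_const) auto
  moreover have "eventually (\<lambda>t. (1 / (2 * (hazard t / t)^2) + ln (hazard t) / (hazard t)^2 +
      (ln (sqrt (2 * pi)) + ?g (Q t)) / (hazard t)\<^sup>2) / ln 2 =
      geometric_entropy (Q t) / (hazard t)\<^sup>2) at_top"
    using eventually_gt_at_top[of 0] order_tendstoD(2)[OF Q_at_top zero_less_one]
  proof eventually_elim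
    case (elim t)
    have "- ln (Q t) = ln (hazard t) - ln (std_normal_density t)"
      unfolding hazard_def using Q_pos[of t] normal_density_pos[of 1 0 t] by (simp add: ln_div)
    also have "ln (std_normal_density t) = - t\<^sup>2 / 2 - ln (sqrt (2 * pi))"
      by (simp add: std_normal_density_def ln_mult ln_div)
    finally have "geometric_entropy (Q t) * ln 2 =
        t^2 / 2 + ln (hazard t) + (ln (sqrt (2 * pi)) + ?g (Q t))"
      using geometric_entropy_eq[OF Q_pos elim(2)] by simp
    then have *: "geometric_entropy (Q t) =
        (t^2 / 2 + ln (hazard t) + (ln (sqrt (2 * pi)) + ?g (Q t))) / ln 2"
      by (simp add: eq_divide_eq)
    have "1 / (2 * (hazard t / t)^2) = (t^2 / 2) / (hazard t)\<^sup>2"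
      using elim by (simp add: power_divide)
    then show ?case
      unfolding * by (simp only: add_divide_distrib[symmetric]) (simp add: mult.commute)
  qed
  ultimately show ?thesis
    by (simp cong: filterlim_cong add: filterlim_cong)
qed

text \<open>Intermediate values between divergence at 0 and the limit 0 at 1. Cutting the interval
  at \<open>1/2\<close> orders the two witnesses.\<close>

lemma geometric_entropy_surj:
  assumes "k > 0" shows "k \<in> geometric_entropy ` {0<..<1}"
proof -
  have cont: "isCont geometric_entropy p" if "0 < p" "p < 1" for p
    unfolding geometric_entropy_def[abs_def] binary_entropy_def[abs_def] log_def using that
    by (intro continuous_intros) auto
  have "filterlim geometric_entropy at_top (at_right 0)"
    unfolding geometric_entropy_def[abs_def] binary_entropy_def[abs_def] log_def by real_asymp
  then have "eventually (\<lambda>p. k \<le> geometric_entropy p \<and> p \<in> {0<..<1/2}) (at_right 0)"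
    by (intro eventually_conj eventually_at_right_real) (auto simp: filterlim_at_top)
  then obtain a where a: "k \<le> geometric_entropy a" "0 < a" "a < 1/2"
    using eventually_happens'[OF trivial_limit_at_right_real] by force
  have "(geometric_entropy \<longlongrightarrow> 0) (at_left 1)"
    unfolding geometric_entropy_def[abs_def] binary_entropy_def[abs_def] log_def by real_asymp
  then have "eventually (\<lambda>p. geometric_entropy p < k \<and> p \<in> {1/2<..<1}) (at_left 1)"
    using assms by (intro eventually_conj eventually_at_left_real) (auto simp: order_tendstoD)
  then obtain b where b: "geometric_entropy b < k" "1/2 < b" "b < 1"
    using eventually_happens'[OF trivial_limit_at_left_real] by force
  obtain x where "a \<le> x" "x \<le> b" "geometric_entropy x = k"
    using IVT2[of geometric_entropy b k a] a b cont by fastforce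
  then show ?thesis using a b by (intro image_eqI[of _ _ x]) auto
qed

text \<open>Both inverses act as right inverses here. All later use of \<open>threshold\<close> goes
  through these two facts.\<close>

lemma threshold_props:
  assumes "k > 0"
  shows "Q (threshold k) < 1" "geometric_entropy (Q (threshold k)) = k"
proof -
  let ?p = "inv_into {0<..<1} geometric_entropy k"
  have p: "?p \<in> {0<..<1}" "geometric_entropy ?p = k"
    using geometric_entropy_surj[OF assms] by (rule inv_into_into, rule f_inv_into_f)
  have "Q (threshold k) = ?p"
    unfolding threshold_def using p by (intro f_inv_into_f Q_surj) auto
  with p show "Q (threshold k) < 1" "geometric_entropy (Q (threshold k)) = k" by auto
qed

text \<open>By \<open>ln x \<le> x - 1\<close>, both summands of \<open>geometric_entropy_eq\<close>
  are at most \<open>1 / (p * p)\<close>. The bound is crude but decreasing in \<open>p\<close>, as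
  \<open>threshold_at_top\<close> requires.\<close>

lemma geometric_entropy_le:
  assumes "0 < p" "p < 1"
  shows "geometric_entropy p \<le> 2 / (p * p * ln 2)"
proof -
  have "ln (1 / p) \<le> 1 / p - 1" using assms by (intro ln_le_minus_one) auto
  then have 1: "- ln p \<le> 1 / p" using assms by (simp add: ln_div)
  have "ln (1 / (1 - p)) \<le> 1 / (1 - p) - 1" using assms by (intro ln_le_minus_one) auto
  then have "- ln (1 - p) \<le> p / (1 - p)" using assms by (simp add: ln_div field_simps)
  then have 2: "- (1 - p) * ln (1 - p) / p \<le> 1" using assms by (simp add: field_simps)
  have "1 \<le> 1 / p" "1 / p \<le> 1 / (p * p)" using assms by (auto simp: field_simps)
  then have "geometric_entropy p * ln 2 \<le> 2 / (p * p)"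
    unfolding geometric_entropy_eq[OF assms] using 1 2 by (simp add: field_simps)
  then show ?thesis
    by (metis ln_gt_zero one_less_numeral_iff pos_le_divide_eq divide_divide_eq_left semiring_norm(76))
qed

text \<open>A threshold below \<open>C\<close> forces \<open>Q (threshold k) \<ge> Q C\<close>, and
  \<open>geometric_entropy_le\<close> then bounds \<open>k\<close> by a constant depending on
  \<open>C\<close> alone.\<close>

lemma threshold_at_top: "filterlim threshold at_top at_top"
  unfolding filterlim_at_top
proof
  fix C
  let ?b = "2 / (Q C * Q C * ln 2)"
  show "eventually (\<lambda>k. C \<le> threshold k) at_top"
    using eventually_gt_at_top[of ?b] eventually_gt_at_top[of 0]
  proof eventually_elim
    case (elim k)
    show ?case
    proof (rule ccontr)
      assume "\<not> C \<le> threshold k"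
      then have le: "Q C \<le> Q (threshold k)" by (intro Q_antimono) auto
      have "k = geometric_entropy (Q (threshold k))" using threshold_props elim by simp
      also have "\<dots> \<le> 2 / (Q (threshold k) * Q (threshold k) * ln 2)"
        using threshold_props elim Q_pos by (intro geometric_entropy_le) auto
      also have "\<dots> \<le> ?b"
        using le Q_pos[of C] Q_pos[of "threshold k"]
        by (intro divide_left_mono mult_right_mono mult_mono) (auto intro!: mult_pos_pos less_imp_le)
      finally show False using elim by simp
    qed
  qed
qed

section \<open>First entry of an i.i.d. sequence\<close>

text \<open>Abstracts \<open>first_exceedance\<close> to sequences of any type, so that it applies
  to the pairs. The default 1 is kept so that the two agree everywhere and not just almost
  surely.\<close>

definition first_entry :: "(nat \<Rightarrow> 'a \<Rightarrow> 'b) \<Rightarrow> 'b set \<Rightarrow> 'a \<Rightarrow> nat" where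
  "first_entry W B \<omega> =
     (if \<exists>i\<ge>1. W i \<omega> \<in> B then LEAST i. 1 \<le> i \<and> W i \<omega> \<in> B else 1)"

lemma first_entry_ge: "1 \<le> first_entry W B \<omega>"
proof (cases "\<exists>i\<ge>1. W i \<omega> \<in> B")
  case True
  then have "\<exists>i. 1 \<le> i \<and> W i \<omega> \<in> B" by blast
  from LeastI_ex[OF this] True show ?thesis by (simp add: first_entry_def)
qed (auto simp: first_entry_def)

lemma first_entry_eq:
  assumes "1 \<le> n" "W n \<omega> \<in> B" "\<forall>i\<in>{1..<n}. W i \<omega> \<notin> B"
  shows "first_entry W B \<omega> = n"
proof -
  have "(LEAST i. 1 \<le> i \<and> W i \<omega> \<in> B) = n"
    using assms by (intro Least_equality) (auto simp: not_less[symmetric])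
  then show ?thesis using assms by (auto simp: first_entry_def)
qed

lemma first_entry_before:
  assumes "\<exists>i\<ge>1. W i \<omega> \<in> B"
  shows "W (first_entry W B \<omega>) \<omega> \<in> B" "\<forall>i\<in>{1..<first_entry W B \<omega>}. W i \<omega> \<notin> B"
proof -
  let ?P = "\<lambda>i. 1 \<le> i \<and> W i \<omega> \<in> B"
  have "\<exists>i. ?P i" using assms by blast
  from LeastI_ex[OF this] show "W (first_entry W B \<omega>) \<omega> \<in> B"
    using assms by (simp add: first_entry_def)
  show "\<forall>i\<in>{1..<first_entry W B \<omega>}. W i \<omega> \<notin> B"
    using assms by (auto simp: first_entry_def dest: not_less_Least)
qed

text \<open>The setting of rejection sampling: proposals with law \<open>D\<close> are drawn until
  one is accepted by \<open>B\<close>.\<close>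

locale first_entry_iid = prob_space M for M :: "'a measure" +
  fixes N D :: "'b measure" and W :: "nat \<Rightarrow> 'a \<Rightarrow> 'b" and B :: "'b set" and p :: real
  assumes indep: "indep_vars (\<lambda>_. N) W {1..}"
    and ident: "\<And>i. 1 \<le> i \<Longrightarrow> distr M N (W i) = D"
    and B[measurable]: "B \<in> sets N"
    and p: "measure D B = p" "0 < p"
begin

abbreviation "J \<equiv> first_entry W B"

lemma W_measurable: "1 \<le> i \<Longrightarrow> W i \<in> measurable M N"
  using indep by (auto simp: indep_vars_def)

lemma prob_W: "1 \<le> i \<Longrightarrow> A \<in> sets N \<Longrightarrow> prob (W i -` A \<inter> space M) = measure D A"
  by (simp add: ident[of i, symmetric] measure_distr W_measurable)

lemma sets_D: "sets D = sets N"
  by (simp add: ident[OF order_refl, symmetric])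

sublocale D: prob_space D
  using prob_space_distr[OF W_measurable, of 1] ident[of 1] by simp

lemma p_le_1: "p \<le> 1"
  using D.prob_le_1[of B] p by simp

lemma J_measurable: "J \<in> measurable M (count_space UNIV)"
proof -
  have P: "Measurable.pred M (\<lambda>\<omega>. 1 \<le> i \<and> W i \<omega> \<in> B)" for i
  proof (cases "1 \<le> i")
    case True
    note W_measurable[OF this, measurable]
    show ?thesis by measurable
  qed simp
  have L: "(\<lambda>\<omega>. LEAST i. 1 \<le> i \<and> W i \<omega> \<in> B) \<in> measurable M (count_space UNIV)"
    by (rule measurable_Least) (rule P)
  have ex: "{\<omega> \<in> space M. \<exists>i. 1 \<le> i \<and> W i \<omega> \<in> B} \<in> events"
    by (rule sets.sets_Collect_countable_Ex) (rule predE[OF P])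
  show ?thesis
    unfolding first_entry_def[abs_def] by (rule measurable_If[OF L _ ex]) simp
qed

text \<open>With codomain \<open>{1..}\<close> the composition rule asks for measurability of
  \<open>W i\<close> at positive indices only; nothing is assumed about \<open>W 0\<close>.\<close>

lemma J_measurable': "J \<in> measurable M (count_space {1..})"
proof -
  have "J \<in> space M \<rightarrow> {1..}"
    by (simp add: Pi_iff first_entry_ge del: One_nat_def)
  from measurable_restrict_space2[OF this J_measurable]
  show ?thesis by (simp add: restrict_count_space)
qed

lemma W_J_measurable: "(\<lambda>\<omega>. W (J \<omega>) \<omega>) \<in> measurable M N"
  by (rule measurable_compose_countable'[where f=W, OF W_measurable J_measurable']) auto

section \<open>Law of the value at the first entry\<close>

definition enters_at :: "nat \<Rightarrow> 'b set \<Rightarrow> 'a set" where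
  "enters_at n A = {\<omega> \<in> space M. W n \<omega> \<in> A \<inter> B \<and> (\<forall>i\<in>{1..<n}. W i \<omega> \<notin> B)}"

text \<open>One preimage for each index up to \<open>n\<close> is the form to which the product rule
  for independent variables applies.\<close>

lemma enters_at_eq:
  assumes "1 \<le> n"
  shows "enters_at n A =
    (\<Inter>i\<in>{1..n}. W i -` (if i = n then A \<inter> B else space N - B) \<inter> space M)"
proof -
  have sp: "W i \<omega> \<in> space N" if "1 \<le> i" "\<omega> \<in> space M" for i \<omega>
    using measurable_space[OF W_measurable] that by simp
  show ?thesis
  proof (intro set_eqI iffI)
    fix \<omega> assume "\<omega> \<in> enters_at n A"
    then show "\<omega> \<in> (\<Inter>i\<in>{1..n}. W i -` (if i = n then A \<inter> B else space N - B) \<inter> space M)"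
      using sp by (auto simp: enters_at_def)
  next
    fix \<omega> assume *: "\<omega> \<in> (\<Inter>i\<in>{1..n}. W i -` (if i = n then A \<inter> B else space N - B) \<inter> space M)"
    then have W: "W i \<omega> \<in> (if i = n then A \<inter> B else space N - B)" if "i \<in> {1..n}" for i
      using that by blast
    have "\<omega> \<in> space M" using * assms by (auto dest: bspec[of _ _ n])
    moreover have "W n \<omega> \<in> A \<inter> B" using W[of n] assms by simp
    moreover have "W i \<omega> \<notin> B" if "i \<in> {1..<n}" for i
      using W[of i] that by simp
    ultimately show "\<omega> \<in> enters_at n A" by (simp add: enters_at_def)
  qed
qed

lemma enters_at_measurable: "1 \<le> n \<Longrightarrow> A \<in> sets N \<Longrightarrow> enters_at n A \<in> events"
  by (simp only: enters_at_eq, rule sets.finite_INT) (auto intro!: measurable_sets[OF W_measurable] simp del: vimage_Int)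

text \<open>By independence, \<open>n - 1\<close> misses of probability \<open>1 - p\<close> each,
  followed by one hit in \<open>A \<inter> B\<close>.\<close>

lemma prob_enters_at:
  assumes n: "1 \<le> n" and A: "A \<in> sets N"
  shows "prob (enters_at n A) = (1 - p) ^ (n - 1) * measure D (A \<inter> B)"
proof -
  have c: "measure D (space N - B) = 1 - p"
    using D.prob_compl[of B] p sets_eq_imp_space_eq[OF sets_D] by (simp add: sets_D)
  have "prob (enters_at n A) =
      (\<Prod>i\<in>{1..n}. prob (W i -` (if i = n then A \<inter> B else space N - B) \<inter> space M))"
    unfolding enters_at_eq[OF n] using n A by (intro indep_varsD[OF indep]) auto
  also have "\<dots> = (\<Prod>i\<in>{1..n}. if i = n then measure D (A \<inter> B) else 1 - p)"
    using A c by (intro prod.cong) (auto simp: prob_W)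
  also have "{1..n} = insert n {1..<n}" using n by auto
  also have "(\<Prod>i\<in>insert n {1..<n}. if i = n then measure D (A \<inter> B) else 1 - p) =
      measure D (A \<inter> B) * (\<Prod>i\<in>{1..<n}. 1 - p)"
    by (subst prod.insert) (auto intro!: prod.cong)
  finally show ?thesis by simp
qed

lemma J_on_enters_at: "1 \<le> n \<Longrightarrow> \<omega> \<in> enters_at n A \<Longrightarrow> J \<omega> = n"
  by (rule first_entry_eq) (simp_all add: enters_at_def)

text \<open>The events are disjoint because each one determines the entry time, and their
  probabilities form a geometric series of ratio \<open>1 - p\<close>.\<close>

lemma prob_Union_enters_at:
  assumes A: "A \<in> sets N"
  shows "prob (\<Union>n. enters_at (Suc n) A) = measure D (A \<inter> B) / p"
proof -
  have "(\<lambda>n. prob (enters_at (Suc n) A)) sums prob (\<Union>n. enters_at (Suc n) A)"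
  proof (rule finite_measure_UNION)
    show "disjoint_family (\<lambda>n. enters_at (Suc n) A)"
      unfolding disjoint_family_on_def
    proof (intro ballI impI equals0I)
      fix m n \<omega> assume "m \<noteq> n" "\<omega> \<in> enters_at (Suc m) A \<inter> enters_at (Suc n) A"
      then show False
        using J_on_enters_at[of "Suc m" \<omega> A] J_on_enters_at[of "Suc n" \<omega> A] by simp
    qed
  qed (simp add: image_subset_iff enters_at_measurable A)
  moreover have "(\<lambda>n. (1 - p) ^ n * measure D (A \<inter> B)) sums (1 / (1 - (1 - p)) * measure D (A \<inter> B))"
    using p p_le_1 by (intro sums_mult2 geometric_sums) auto
  ultimately show ?thesis
    using prob_enters_at[OF _ A] by (simp add: sums_iff)
qed

text \<open>For \<open>A\<close> the whole space, the union of the entry events has probability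
  \<open>p / p = 1\<close>.\<close>

lemma AE_enters: "AE \<omega> in M. \<exists>i\<ge>1. W i \<omega> \<in> B"
proof -
  have "measure D (space N \<inter> B) = p"
    using p sets.Int_space_eq1[OF B] by simp
  then have "prob (\<Union>n. enters_at (Suc n) (space N)) = 1"
    using p by (simp add: prob_Union_enters_at)
  then have "AE \<omega> in M. \<omega> \<in> (\<Union>n. enters_at (Suc n) (space N))"
    by (rule prob_eq_1[THEN iffD1, rotated]) (auto intro!: enters_at_measurable)
  then show ?thesis
  proof eventually_elim
    case (elim \<omega>)
    then obtain n where "W (Suc n) \<omega> \<in> B" by (auto simp: enters_at_def)
    then show ?case by (intro exI[of _ "Suc n"]) simp
  qed
qed

text \<open>Once the sequence enters \<open>B\<close>, landing in \<open>A\<close> at the entry time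
  means lying in exactly one of the disjoint entry events. On the exceptional null event
  \<open>J\<close> has its default value, so the two events agree only almost everywhere.\<close>

lemma prob_W_J:
  assumes A: "A \<in> sets N"
  shows "prob {\<omega> \<in> space M. W (J \<omega>) \<omega> \<in> A} = measure D (A \<inter> B) / p"
proof -
  have "prob {\<omega> \<in> space M. W (J \<omega>) \<omega> \<in> A} = prob (\<Union>n. enters_at (Suc n) A)"
  proof (rule finite_measure_eq_AE)
    show "AE \<omega> in M. \<omega> \<in> {\<omega> \<in> space M. W (J \<omega>) \<omega> \<in> A} \<longleftrightarrow> \<omega> \<in> (\<Union>n. enters_at (Suc n) A)"
      using AE_enters AE_space
    proof eventually_elim
      case (elim \<omega>)
      note J = first_entry_before[where W=W and B=B, OF elim(1)] first_entry_ge[of W B \<omega>]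
      show ?case
      proof
        assume "\<omega> \<in> {\<omega> \<in> space M. W (J \<omega>) \<omega> \<in> A}"
        \<comment> \<open>The union is indexed from 0 and entry times from 1;
          \<open>Suc (J \<omega> - 1)\<close> is \<open>J \<omega>\<close> since the latter is
          positive.\<close>
        then have "\<omega> \<in> enters_at (Suc (J \<omega> - 1)) A"
          using J by (auto simp: enters_at_def)
        then show "\<omega> \<in> (\<Union>n. enters_at (Suc n) A)" by blast
      next
        assume "\<omega> \<in> (\<Union>n. enters_at (Suc n) A)"
        then obtain n where n: "\<omega> \<in> enters_at (Suc n) A" by blast
        with J_on_enters_at[OF _ n] show "\<omega> \<in> {\<omega> \<in> space M. W (J \<omega>) \<omega> \<in> A}"
          by (auto simp: enters_at_def)
      qed
    qed
    show "{\<omega> \<in> space M. W (J \<omega>) \<omega> \<in> A} \<in> events"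
      using measurable_sets[OF W_J_measurable A] by (simp add: vimage_def Int_def conj_commute)
  qed (auto intro!: enters_at_measurable A)
  then show ?thesis by (simp add: prob_Union_enters_at A)
qed

text \<open>This is \<open>D\<close> conditioned on \<open>B\<close>, written as a density so that
  integrals transfer directly.\<close>

lemma distr_W_J:
  "distr M N (\<lambda>\<omega>. W (J \<omega>) \<omega>) = density D (\<lambda>x. ennreal (indicator B x / p))"
proof (rule measure_eqI)
  fix A assume "A \<in> sets (distr M N (\<lambda>\<omega>. W (J \<omega>) \<omega>))"
  then have A[measurable]: "A \<in> sets N" by simp
  have AB: "A \<in> sets D" "B \<in> sets D" using A B by (simp_all add: sets_D)
  have "emeasure (density D (\<lambda>x. ennreal (indicator B x / p))) A =
      (\<integral>\<^sup>+x. ennreal (1 / p) * indicator (A \<inter> B) x \<partial>D)"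
    using AB by (subst emeasure_density) (auto intro!: nn_integral_cong split: split_indicator)
  also have "\<dots> = ennreal (measure D (A \<inter> B) / p)"
    using AB p by (subst nn_integral_cmult_indicator)
      (auto simp: D.emeasure_eq_measure ennreal_mult''[symmetric])
  also have "\<dots> = emeasure M {\<omega> \<in> space M. W (J \<omega>) \<omega> \<in> A}"
    by (simp add: emeasure_eq_measure prob_W_J)
  also have "\<dots> = emeasure (distr M N (\<lambda>\<omega>. W (J \<omega>) \<omega>)) A"
    using W_J_measurable by (subst emeasure_distr) (auto simp: vimage_def Int_def conj_commute)
  finally show "emeasure (distr M N (\<lambda>\<omega>. W (J \<omega>) \<omega>)) A =
      emeasure (density D (\<lambda>x. ennreal (indicator B x / p))) A" by simp
qed (simp add: sets_D)

text \<open>The right-hand side is pulled back from \<open>D\<close> to \<open>W 1\<close>, so that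
  the joint law of the first pair of inputs can be used in later computations.\<close>

lemma nn_integral_W_J:
  assumes u: "u \<in> borel_measurable N"
  shows "(\<integral>\<^sup>+\<omega>. u (W (J \<omega>) \<omega>) \<partial>M) = (\<integral>\<^sup>+\<omega>. ennreal (indicator B (W 1 \<omega>) / p) * u (W 1 \<omega>) \<partial>M)"
proof -
  note [measurable] = u W_J_measurable W_measurable[OF order_refl]
  have [measurable_cong]: "sets D = sets N" by (rule sets_D)
  have "(\<integral>\<^sup>+\<omega>. u (W (J \<omega>) \<omega>) \<partial>M) = (\<integral>\<^sup>+x. u x \<partial>distr M N (\<lambda>\<omega>. W (J \<omega>) \<omega>))"
    by (simp add: nn_integral_distr)
  also have "\<dots> = (\<integral>\<^sup>+x. ennreal (indicator B x / p) * u x \<partial>D)"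
    unfolding distr_W_J by (subst nn_integral_density) auto
  also have "\<dots> = (\<integral>\<^sup>+\<omega>. ennreal (indicator B (W 1 \<omega>) / p) * u (W 1 \<omega>) \<partial>M)"
    unfolding ident[OF order_refl, symmetric] by (subst nn_integral_distr) (auto simp del: One_nat_def)
  finally show ?thesis .
qed

lemma has_bochner_integral_W_J:
  fixes u :: "'b \<Rightarrow> real"
  assumes u: "u \<in> borel_measurable N"
    and I: "has_bochner_integral M (\<lambda>\<omega>. indicator B (W 1 \<omega>) * u (W 1 \<omega>)) c"
  shows "has_bochner_integral M (\<lambda>\<omega>. u (W (J \<omega>) \<omega>)) (c / p)"
proof -
  note [measurable] = u W_J_measurable W_measurable[OF order_refl]
  have [measurable_cong]: "sets D = sets N" by (rule sets_D)
  have "has_bochner_integral (distr M N (W 1)) (\<lambda>x. indicator B x * u x) c"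
    using I by (intro has_bochner_integral_distr) (auto simp del: One_nat_def)
  then have "has_bochner_integral D (\<lambda>x. (indicator B x * u x) / p) (c / p)"
    unfolding ident[OF order_refl] by (rule has_bochner_integral_divide_zero)
  then have "has_bochner_integral (density D (\<lambda>x. ennreal (indicator B x / p))) u (c / p)"
    using p by (intro has_bochner_integral_density) (auto simp: mult_ac)
  then have "has_bochner_integral (distr M N (\<lambda>\<omega>. W (J \<omega>) \<omega>)) u (c / p)"
    by (simp add: distr_W_J)
  then show ?thesis
    by (simp add: has_bochner_integral_iff integrable_distr_eq integral_distr)
qed

section \<open>Law and entropy of the entry time\<close>

definition geometric_mass :: "nat \<Rightarrow> real" where
  "geometric_mass n = (if n = 0 then 0 else (1 - p) ^ (n - 1) * p)"

lemma prob_J: "prob (J -` {n} \<inter> space M) = geometric_mass n"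
proof (cases "n = 0")
  case True
  have J: "J \<omega> \<noteq> 0" for \<omega> using first_entry_ge[of W B \<omega>] by simp
  have "J -` {n} \<inter> space M = {}" by (simp add: vimage_def True J)
  then show ?thesis using True by (simp add: geometric_mass_def)
next
  case False
  have "prob (J -` {n} \<inter> space M) = prob (enters_at n (space N))"
  proof (rule finite_measure_eq_AE)
    show "AE \<omega> in M. \<omega> \<in> J -` {n} \<inter> space M \<longleftrightarrow> \<omega> \<in> enters_at n (space N)"
      using AE_enters AE_space
    proof eventually_elim
      case (elim \<omega>)
      have "W n \<omega> \<in> space N"
        using W_measurable[of n] False elim(2) by (auto dest: measurable_space)
      then have "\<omega> \<in> enters_at n (space N)" if "J \<omega> = n"
        using first_entry_before[where W=W and B=B, OF elim(1)] elim(2) that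
        by (simp add: enters_at_def)
      moreover have "J \<omega> = n" if "\<omega> \<in> enters_at n (space N)"
        using J_on_enters_at[OF _ that] False by simp
      ultimately show ?case
        using elim(2) by blast
    qed
    show "J -` {n} \<inter> space M \<in> events" using measurable_sets[OF J_measurable] by simp
  qed (use False enters_at_measurable in auto)
  also have "\<dots> = geometric_mass n"
    using False p sets.Int_space_eq1[OF B] by (simp add: prob_enters_at geometric_mass_def)
  finally show ?thesis .
qed

lemma distributed_J: "distributed M (count_space UNIV) J (\<lambda>n. ennreal (geometric_mass n))"
  unfolding distributed_def
proof (intro conjI)
  show "distr M (count_space UNIV) J = density (count_space UNIV) (\<lambda>n. ennreal (geometric_mass n))"
  proof (rule measure_eqI_countable[of _ UNIV])
    fix n :: nat
    show "emeasure (distr M (count_space UNIV) J) {n} =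
        emeasure (density (count_space UNIV) (\<lambda>n. ennreal (geometric_mass n))) {n}"
      using J_measurable
      by (simp add: emeasure_distr emeasure_eq_measure prob_J emeasure_density
          nn_integral_indicator_singleton mult.commute)
  qed auto
qed (auto intro: J_measurable)

text \<open>The logarithm of the geometric mass is affine in \<open>n\<close>, so the entropy series
  combines the sums of \<open>(1 - p)^n\<close> and \<open>n * (1 - p)^n\<close>.\<close>

lemma entropy_J:
  assumes "p < 1"
  shows "entropy 2 (count_space UNIV) J = geometric_entropy p"
proof -
  interpret information_space M 2 by standard simp
  let ?f = "\<lambda>n. geometric_mass n * log 2 (geometric_mass n)"
  let ?g = "\<lambda>n. (1 - p) ^ n * real n * (p * log 2 (1 - p)) + (1 - p) ^ n * (p * log 2 p)"
  have f: "?f (Suc n) = ?g n" for n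
    using p assms
    by (simp add: geometric_mass_def log_mult log_nat_power algebra_simps)
  let ?s = "(1 - p) / (1 - (1 - p))\<^sup>2 * (p * log 2 (1 - p)) + 1 / (1 - (1 - p)) * (p * log 2 p)"
  have "?g sums ?s"
    using p assms by (intro sums_add sums_mult2 geometric_sums geometric_sums_times_n) auto
  \<comment> \<open>The shift of index loses nothing, because the term at 0 has mass 0.\<close>
  then have sums: "?f sums ?s"
    using sums_Suc_iff[of ?f ?s] f by (simp add: geometric_mass_def)
  \<comment> \<open>All terms have one sign, so convergence of the series is absolute and yields
    integrability over the counting measure.\<close>
  have nonpos: "?f n \<le> 0" for n
  proof -
    have "0 \<le> geometric_mass n" "geometric_mass n \<le> 1"
      using prob_J[of n] by (metis measure_nonneg, metis prob_le_1)
    then show ?thesis by (cases "geometric_mass n = 0") (auto intro!: mult_nonneg_nonpos)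
  qed
  have "integrable (count_space UNIV) ?f"
    unfolding integrable_count_space_nat_iff
    using summable_minus[OF sums_summable[OF sums]] nonpos by (simp add: abs_of_nonpos del: abs_mult)
  then have "(\<integral>n. ?f n \<partial>count_space UNIV) = ?s"
    using sums by (simp add: integral_count_space_nat sums_iff)
  moreover have "entropy 2 (count_space UNIV) J = - (\<integral>n. ?f n \<partial>count_space UNIV)"
    using p assms by (intro entropy_distr[OF distributed_J]) (auto simp: geometric_mass_def)
  moreover have "- ?s = geometric_entropy p"
    using p by (simp add: geometric_entropy_def binary_entropy_def power2_eq_square field_simps)
  ultimately show ?thesis by simp
qed

end

section \<open>Moments and Fisher information of the selected pair\<close>

text \<open>The set is a cylinder over the first coordinate, so \<open>V\<close> is free; taking the
  noisy copy for \<open>V\<close> makes the index an entry time of the sequence of pairs.\<close>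

lemma first_exceedance_eq:
  "first_exceedance X t = first_entry (\<lambda>i \<omega>. (X i \<omega>, V i \<omega>)) ({t<..} \<times> UNIV)"
  by (auto simp: fun_eq_iff first_exceedance_def first_entry_def)

section \<open>Score of the conditional normal density\<close>

lemma normal_density_standardize:
  "0 < c \<Longrightarrow> c * normal_density m c (m + c * z) = std_normal_density z"
  by (simp add: normal_density_def real_sqrt_mult power_mult_distrib)

lemma distributed_has_bochner_integral:
  fixes g :: "'b \<Rightarrow> real"
  assumes D: "distributed M N T (\<lambda>x. ennreal (f x))" and f: "\<And>x. 0 \<le> f x"
    and g: "g \<in> borel_measurable N" and I: "has_bochner_integral M (\<lambda>\<omega>. g (T \<omega>)) c"
  shows "has_bochner_integral N (\<lambda>x. f x * g x) c"
  using distributed_integrable[OF D g] distributed_integral[OF D g] f I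
  by (simp add: has_bochner_integral_iff)

text \<open>The score of the law of \<open>Y\<close> given \<open>X = x\<close>. The middle term
  comes from the mean \<open>r * x\<close>, the outer two from the variance \<open>1 - r^2\<close>,
  which moves with the parameter as well.\<close>

lemma normal_log_density_deriv:
  assumes r: "r \<in> {-1<..<1}"
  shows "((\<lambda>r. ln (normal_density (r * x) (sqrt (1 - r\<^sup>2)) y)) has_real_derivative
    (r / (1 - r\<^sup>2) + x * (y - r * x) / (1 - r\<^sup>2) - r * (y - r * x)\<^sup>2 / (1 - r\<^sup>2)\<^sup>2)) (at r)"
proof (rule has_field_derivative_transform_within_open)
  let ?L = "\<lambda>r. - ln (2 * pi) / 2 - ln (1 - r\<^sup>2) / 2 - (y - r * x)\<^sup>2 / (2 * (1 - r\<^sup>2))"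
  have pos: "0 < 1 - r\<^sup>2" if "r \<in> {-1<..<1}" for r :: real
    using that by (simp add: abs_square_less_1 abs_less_iff)
  define v where "v = 1 - r\<^sup>2"
  have v: "v > 0" using pos[OF r] by (simp add: v_def)
  have "((\<lambda>r. ln (1 - r\<^sup>2)) has_real_derivative - (2 * r) / v) (at r)"
    using v unfolding v_def by (auto intro!: derivative_eq_intros simp: field_simps)
  moreover have "((\<lambda>r. (y - r * x)\<^sup>2 / (2 * (1 - r\<^sup>2))) has_real_derivative
      (2 * (y - r * x) * (- x) * (2 * v) - (y - r * x)\<^sup>2 * (- (4 * r))) / (2 * v)\<^sup>2) (at r)"
    using v unfolding v_def by (auto intro!: derivative_eq_intros simp: power2_eq_square)
  ultimately have "(?L has_real_derivative 0 - (- (2 * r) / v) / 2 -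
      (2 * (y - r * x) * (- x) * (2 * v) - (y - r * x)\<^sup>2 * (- (4 * r))) / (2 * v)\<^sup>2) (at r)"
    by (intro DERIV_diff DERIV_cdivide DERIV_const) auto
  also have "0 - (- (2 * r) / v) / 2 -
      (2 * (y - r * x) * (- x) * (2 * v) - (y - r * x)\<^sup>2 * (- (4 * r))) / (2 * v)\<^sup>2 =
      r / v + x * (y - r * x) / v - r * (y - r * x)\<^sup>2 / v\<^sup>2"
    using v by (simp add: field_simps power2_eq_square)
  finally show "(?L has_real_derivative
    (r / (1 - r\<^sup>2) + x * (y - r * x) / (1 - r\<^sup>2) - r * (y - r * x)\<^sup>2 / (1 - r\<^sup>2)\<^sup>2)) (at r)"
    by (simp add: v_def)
  show "?L r = ln (normal_density (r * x) (sqrt (1 - r\<^sup>2)) y)" if "r \<in> {-1<..<1}" for r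
    using pos[OF that] by (simp add: normal_density_def ln_mult ln_div ln_sqrt add_divide_distrib)
qed (use r in auto)

text \<open>On the open interval the density is positive, hence equal to \<open>exp\<close> of its
  logarithm, whose derivative is known.\<close>

lemma normal_density_differentiable:
  "(\<lambda>r. normal_density (r * x) (sqrt (1 - r\<^sup>2)) y) differentiable_on {-1<..<1}"
  unfolding differentiable_on_def
proof
  fix r :: real assume r: "r \<in> {-1<..<1}"
  have pos: "0 < normal_density (r * x) (sqrt (1 - r\<^sup>2)) y" if "r \<in> {-1<..<1}" for r
    using that by (intro normal_density_pos) (simp add: abs_square_less_1 abs_less_iff)
  have "((\<lambda>r. normal_density (r * x) (sqrt (1 - r\<^sup>2)) y) has_real_derivative
      exp (ln (normal_density (r * x) (sqrt (1 - r\<^sup>2)) y)) *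
      (r / (1 - r\<^sup>2) + x * (y - r * x) / (1 - r\<^sup>2) - r * (y - r * x)\<^sup>2 / (1 - r\<^sup>2)\<^sup>2)) (at r)"
    by (rule has_field_derivative_transform_within_open[OF DERIV_fun_exp[OF normal_log_density_deriv[OF r]], of "{-1<..<1}"])
       (use r pos in auto)
  then show "(\<lambda>r. normal_density (r * x) (sqrt (1 - r\<^sup>2)) y) differentiable at r within {-1<..<1}"
    using real_differentiable_def differentiable_at_withinI by blast
qed

section \<open>Moments of the selected pair\<close>

locale thresholded_pairs = prob_space M for M :: "'a measure" +
  fixes X Z :: "nat \<Rightarrow> 'a \<Rightarrow> real" and \<rho> t :: real
  assumes rho: "\<bar>\<rho>\<bar> \<le> 1"
    and X: "\<And>i. 1 \<le> i \<Longrightarrow> distributed M lborel (X i) std_normal_density"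
    and Z: "\<And>i. 1 \<le> i \<Longrightarrow> distributed M lborel (Z i) std_normal_density"
    and XZ: "\<And>i. 1 \<le> i \<Longrightarrow> indep_var borel (X i) borel (Z i)"
    and indep_pairs: "indep_vars (\<lambda>_. borel) (\<lambda>i \<omega>. (X i \<omega>, noisy_copy X Z \<rho> i \<omega>)) {1..}"
begin

abbreviation "Y \<equiv> noisy_copy X Z \<rho>"
abbreviation "W \<equiv> (\<lambda>i \<omega>. (X i \<omega>, Y i \<omega>))"
abbreviation "B \<equiv> {t<..} \<times> (UNIV :: real set)"
abbreviation "s \<equiv> sqrt (1 - \<rho>\<^sup>2)"

lemma rho_sq_le_1: "\<rho>\<^sup>2 \<le> 1"
  using rho by (simp add: abs_square_le_1)

lemma X_measurable: "1 \<le> i \<Longrightarrow> X i \<in> borel_measurable M"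
  using distributed_measurable[OF X] by simp

lemma Z_measurable: "1 \<le> i \<Longrightarrow> Z i \<in> borel_measurable M"
  using distributed_measurable[OF Z] by simp

lemma distr_pair:
  assumes i: "1 \<le> i"
  shows "distr M (borel \<Otimes>\<^sub>M borel) (\<lambda>\<omega>. (X i \<omega>, Z i \<omega>)) = std_normal_distribution \<Otimes>\<^sub>M std_normal_distribution"
proof -
  have "distr M borel (X i) = std_normal_distribution" "distr M borel (Z i) = std_normal_distribution"
    using distributed_distr_eq_density[OF X[OF i]] distributed_distr_eq_density[OF Z[OF i]]
    by (simp_all cong: distr_cong)
  then show ?thesis
    using XZ[OF i] unfolding indep_var_distribution_eq by simp
qed

text \<open>The right-hand side is free of \<open>i\<close>, which supplies the identical
  distribution required by \<open>first_entry_iid\<close>.\<close>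

lemma distr_W:
  assumes i: "1 \<le> i"
  shows "distr M borel (W i) =
    distr (std_normal_distribution \<Otimes>\<^sub>M std_normal_distribution) borel (\<lambda>(x, z). (x, \<rho> * x + s * z))"
proof -
  note [measurable] = X_measurable[OF i] Z_measurable[OF i]
  have "distr M borel (W i) =
      distr (distr M (borel \<Otimes>\<^sub>M borel) (\<lambda>\<omega>. (X i \<omega>, Z i \<omega>))) borel (\<lambda>(x, z). (x, \<rho> * x + s * z))"
    by (subst distr_distr) (auto simp: comp_def noisy_copy_def borel_prod[symmetric])
  then show ?thesis by (simp add: distr_pair[OF i])
qed

text \<open>Independence of input and noise splits each moment of the first pair into two
  one-dimensional Gaussian integrals; truncation enters through an indicator inside
  \<open>f\<close>.\<close>

lemma moment_product:
  fixes f g :: "real \<Rightarrow> real"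
  assumes f[measurable]: "f \<in> borel_measurable borel" and g[measurable]: "g \<in> borel_measurable borel"
    and a: "has_bochner_integral lborel (\<lambda>u. std_normal_density u * f u) a"
    and b: "has_bochner_integral lborel (\<lambda>u. std_normal_density u * g u) b"
  shows "has_bochner_integral M (\<lambda>\<omega>. f (X 1 \<omega>) * g (Z 1 \<omega>)) (a * b)"
proof -
  have fX: "integrable M (\<lambda>\<omega>. f (X 1 \<omega>))" "expectation (\<lambda>\<omega>. f (X 1 \<omega>)) = a"
    using a distributed_integrable[OF X[OF order_refl], of f] distributed_integral[OF X[OF order_refl], of f]
    by (auto simp: has_bochner_integral_iff)
  have gZ: "integrable M (\<lambda>\<omega>. g (Z 1 \<omega>))" "expectation (\<lambda>\<omega>. g (Z 1 \<omega>)) = b"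
    using b distributed_integrable[OF Z[OF order_refl], of g] distributed_integral[OF Z[OF order_refl], of g]
    by (auto simp: has_bochner_integral_iff)
  have "indep_var borel (f \<circ> X 1) borel (g \<circ> Z 1)"
    by (rule indep_var_compose[OF XZ[OF order_refl]]) auto
  then have "indep_var borel (\<lambda>\<omega>. f (X 1 \<omega>)) borel (\<lambda>\<omega>. g (Z 1 \<omega>))"
    by (simp only: comp_def)
  from indep_var_lebesgue_integral[OF this fX(1) gZ(1)] indep_var_integrable[OF this fX(1) gZ(1)]
  show ?thesis
    using fX gZ by (simp add: has_bochner_integral_iff)
qed

lemma prob_exceed: "measure (distr M borel (W 1)) B = Q t"
proof -
  note [measurable] = X_measurable[OF order_refl] Z_measurable[OF order_refl]
  have [measurable]: "W 1 \<in> borel_measurable M"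
    unfolding borel_prod[symmetric] noisy_copy_def by measurable
  have B: "B \<in> sets borel"
    unfolding borel_prod[symmetric] by (intro pair_measureI) auto
  have "measure (distr M borel (W 1)) B = expectation (\<lambda>\<omega>. indicator {t<..} (X 1 \<omega>) * 1)"
  proof -
    have "measure (distr M borel (W 1)) B = prob (W 1 -` B \<inter> space M)"
      using B by (intro measure_distr) (auto simp del: One_nat_def)
    also have "\<dots> = expectation (indicator (W 1 -` B \<inter> space M))"
      by simp
    also have "\<dots> = expectation (\<lambda>\<omega>. indicator {t<..} (X 1 \<omega>) * 1)"
      by (intro Bochner_Integration.integral_cong) (auto split: split_indicator)
    finally show ?thesis .
  qed
  also have "\<dots> = Q t * 1"
    using moment_product[of "indicator {t<..}" "\<lambda>_. 1", OF _ _ normal_tail_integral, of 1]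
      std_normal_moment_even[of 0]
    by (simp add: has_bochner_integral_iff)
  finally show ?thesis by simp
qed

sublocale F: first_entry_iid M borel "distr M borel (W 1)" W B "Q t"
proof
  show "indep_vars (\<lambda>_. borel) W {1..}" by (rule indep_pairs)
  show "distr M borel (W i) = distr M borel (W 1)" if "1 \<le> i" for i
    unfolding distr_W[OF that] distr_W[OF order_refl] ..
  show "B \<in> sets borel"
    unfolding borel_prod[symmetric] by (intro pair_measureI) auto
qed (rule prob_exceed Q_pos)+

abbreviation "J \<equiv> first_exceedance X t"

lemma J_eq: "J = F.J"
  by (rule first_exceedance_eq)

text \<open>The source of every moment at the random index below: \<open>moment_product\<close>
  evaluates the truncated moment, and division by \<open>Q t\<close> conditions on
  exceedance.\<close>

lemma selected_moment:
  fixes u :: "real \<times> real \<Rightarrow> real"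
  assumes "u \<in> borel_measurable borel"
    and "has_bochner_integral M (\<lambda>\<omega>. indicator {t<..} (X 1 \<omega>) * u (X 1 \<omega>, Y 1 \<omega>)) c"
  shows "has_bochner_integral M (\<lambda>\<omega>. u (at_index X J \<omega>, at_index Y J \<omega>)) (c / Q t)"
  unfolding at_index_def J_eq
  using F.has_bochner_integral_W_J[of u c] assms by (simp add: indicator_times)

lemma std_moments:
  "has_bochner_integral lborel (\<lambda>u. std_normal_density u * 1) 1"
  "has_bochner_integral lborel (\<lambda>u. std_normal_density u * u) 0"
  "has_bochner_integral lborel (\<lambda>u. std_normal_density u * u\<^sup>2) 1"
  "has_bochner_integral lborel (\<lambda>u. std_normal_density u * u^3) 0"
  "has_bochner_integral lborel (\<lambda>u. std_normal_density u * u^4) 3"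
  using std_normal_moment_even[of 0] std_normal_moment_odd[of 0] std_normal_moment_even[of 1]
    std_normal_moment_odd[of 1] std_normal_moment_even[of 2]
  by (simp_all add: fact_numeral eval_nat_numeral)

lemma expectation_X_J: "has_bochner_integral M (at_index X J) (hazard t)"
proof -
  have "has_bochner_integral M (\<lambda>\<omega>. (indicator {t<..} (X 1 \<omega>) * X 1 \<omega>) * 1) (std_normal_density t * 1)"
    by (rule moment_product[OF _ _ normal_tail_first_moment std_moments(1)]) auto
  then show ?thesis
    using selected_moment[of fst "std_normal_density t"]
    by (simp add: hazard_def borel_prod[symmetric])
qed

text \<open>Selection looks at \<open>X\<close> alone, so the noise keeps mean zero and only
  \<open>\<rho>\<close> times the truncated mean remains.\<close>

lemma expectation_Y_J: "has_bochner_integral M (at_index Y J) (\<rho> * hazard t)"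
proof -
  have "has_bochner_integral M (\<lambda>\<omega>. \<rho> * ((indicator {t<..} (X 1 \<omega>) * X 1 \<omega>) * 1) +
      s * (indicator {t<..} (X 1 \<omega>) * Z 1 \<omega>)) (\<rho> * (std_normal_density t * 1) + s * (Q t * 0))"
    by (intro has_bochner_integral_add has_bochner_integral_mult_right
        moment_product[OF _ _ normal_tail_first_moment std_moments(1)]
        moment_product[OF _ _ normal_tail_integral std_moments(2)]) auto
  then have "has_bochner_integral M (\<lambda>\<omega>. indicator {t<..} (X 1 \<omega>) * snd (X 1 \<omega>, Y 1 \<omega>))
      (\<rho> * std_normal_density t)"
    by (simp add: noisy_copy_def algebra_simps)
  from selected_moment[OF _ this] show ?thesis
    by (simp add: hazard_def borel_prod[symmetric])
qed

text \<open>In the expanded square the cross term vanishes with the noise mean, and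
  \<open>\<rho>^2 + s^2 = 1\<close> merges the two constant parts.\<close>

lemma expectation_Y_J_squared:
  "has_bochner_integral M (\<lambda>\<omega>. (at_index Y J \<omega>)\<^sup>2) (1 + \<rho>\<^sup>2 * t * hazard t)"
proof -
  have "has_bochner_integral M (\<lambda>\<omega>. \<rho>\<^sup>2 * ((indicator {t<..} (X 1 \<omega>) * (X 1 \<omega>)\<^sup>2) * 1) +
      2 * \<rho> * s * ((indicator {t<..} (X 1 \<omega>) * X 1 \<omega>) * Z 1 \<omega>) +
      s\<^sup>2 * (indicator {t<..} (X 1 \<omega>) * (Z 1 \<omega>)\<^sup>2))
      (\<rho>\<^sup>2 * ((t * std_normal_density t + Q t) * 1) + 2 * \<rho> * s * (std_normal_density t * 0) +
       s\<^sup>2 * (Q t * 1))"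
    by (intro has_bochner_integral_add has_bochner_integral_mult_right
        moment_product[OF _ _ normal_tail_second_moment std_moments(1)]
        moment_product[OF _ _ normal_tail_first_moment std_moments(2)]
        moment_product[OF _ _ normal_tail_integral std_moments(3)]) auto
  also have "(\<lambda>\<omega>. \<rho>\<^sup>2 * ((indicator {t<..} (X 1 \<omega>) * (X 1 \<omega>)\<^sup>2) * 1) +
      2 * \<rho> * s * ((indicator {t<..} (X 1 \<omega>) * X 1 \<omega>) * Z 1 \<omega>) +
      s\<^sup>2 * (indicator {t<..} (X 1 \<omega>) * (Z 1 \<omega>)\<^sup>2)) =
      (\<lambda>\<omega>. indicator {t<..} (X 1 \<omega>) * (snd (X 1 \<omega>, Y 1 \<omega>))\<^sup>2)"
    by (simp add: noisy_copy_def algebra_simps power2_eq_square fun_eq_iff)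
  finally have *: "has_bochner_integral M (\<lambda>\<omega>. indicator {t<..} (X 1 \<omega>) * (snd (X 1 \<omega>, Y 1 \<omega>))\<^sup>2)
      (\<rho>\<^sup>2 * ((t * std_normal_density t + Q t) * 1) + 2 * \<rho> * s * (std_normal_density t * 0) +
       s\<^sup>2 * (Q t * 1))" .
  have "has_bochner_integral M (\<lambda>\<omega>. (snd (at_index X J \<omega>, at_index Y J \<omega>))\<^sup>2)
      ((\<rho>\<^sup>2 * ((t * std_normal_density t + Q t) * 1) + 2 * \<rho> * s * (std_normal_density t * 0) +
       s\<^sup>2 * (Q t * 1)) / Q t)"
    by (rule selected_moment[OF _ *]) (simp add: borel_prod[symmetric])
  also have "(\<rho>\<^sup>2 * ((t * std_normal_density t + Q t) * 1) + 2 * \<rho> * s * (std_normal_density t * 0) +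
       s\<^sup>2 * (Q t * 1)) / Q t = 1 + \<rho>\<^sup>2 * t * hazard t"
    using Q_pos[of t] rho_sq_le_1 by (simp add: hazard_def field_simps)
  finally show ?thesis by simp
qed

section \<open>Fisher information of the selected pair\<close>

definition score :: "real \<Rightarrow> real \<times> real \<Rightarrow> real" where
  "score r = (\<lambda>(x, y). r / (1 - r\<^sup>2) + x * (y - r * x) / (1 - r\<^sup>2) - r * (y - r * x)\<^sup>2 / (1 - r\<^sup>2)\<^sup>2)"

text \<open>Along \<open>y = \<rho> * x + s * z\<close> the score is
  \<open>(\<rho> * (1 - z^2) + s * x * z) / (1 - \<rho>^2)\<close>. Its square is a sum of three
  products of a function of \<open>x\<close> and one of \<open>z\<close>, each within reach of
  \<open>moment_product\<close>.\<close>

lemma expectation_score_squared: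
  assumes r: "\<bar>\<rho>\<bar> < 1"
  shows "has_bochner_integral M (\<lambda>\<omega>. (score \<rho> (at_index X J \<omega>, at_index Y J \<omega>))\<^sup>2)
    (2 * \<rho>\<^sup>2 / (1 - \<rho>\<^sup>2)\<^sup>2 + (1 + t * hazard t) / (1 - \<rho>\<^sup>2))"
proof -
  have s: "0 < 1 - \<rho>\<^sup>2" using r by (simp add: abs_square_less_1)
  let ?i = "\<lambda>\<omega>. indicator {t<..} (X 1 \<omega>) :: real"
  let ?F = "\<lambda>\<omega>. (\<rho>\<^sup>2 / (1 - \<rho>\<^sup>2)\<^sup>2) * (?i \<omega> * (1 - 2 * (Z 1 \<omega>)\<^sup>2 + (Z 1 \<omega>)^4)) +
      (2 * \<rho> * s / (1 - \<rho>\<^sup>2)\<^sup>2) * ((?i \<omega> * X 1 \<omega>) * (Z 1 \<omega> - (Z 1 \<omega>)^3)) +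
      (1 / (1 - \<rho>\<^sup>2)) * ((?i \<omega> * (X 1 \<omega>)\<^sup>2) * (Z 1 \<omega>)\<^sup>2)"
  let ?c = "(\<rho>\<^sup>2 / (1 - \<rho>\<^sup>2)\<^sup>2) * (Q t * 2) + (2 * \<rho> * s / (1 - \<rho>\<^sup>2)\<^sup>2) * (std_normal_density t * 0) +
      (1 / (1 - \<rho>\<^sup>2)) * ((t * std_normal_density t + Q t) * 1)"
  \<comment> \<open>The value is \<open>1 - 2 + 3\<close>, from the Gaussian moments 1, 1 and 3 of
    orders 0, 2 and 4.\<close>
  have m2: "has_bochner_integral lborel (\<lambda>u. std_normal_density u * (1 - 2 * u\<^sup>2 + u^4)) 2"
    using has_bochner_integral_add[OF has_bochner_integral_diff[OF std_moments(1)
      has_bochner_integral_mult_right[of 2, OF std_moments(3)]] std_moments(5)]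
    by (simp add: algebra_simps)
  have m1: "has_bochner_integral lborel (\<lambda>u. std_normal_density u * (u - u^3)) 0"
    using has_bochner_integral_diff[OF std_moments(2) std_moments(4)]
    by (simp add: algebra_simps)
  have *: "has_bochner_integral M ?F ?c"
    by (intro has_bochner_integral_add has_bochner_integral_mult_right
        moment_product[OF _ _ normal_tail_integral m2]
        moment_product[OF _ _ normal_tail_first_moment m1]
        moment_product[OF _ _ normal_tail_second_moment std_moments(3)]) auto
  have sc: "(score \<rho> (x, \<rho> * x + s * z))\<^sup>2 =
      (\<rho>\<^sup>2 / (1 - \<rho>\<^sup>2)\<^sup>2) * (1 - 2 * z\<^sup>2 + z^4) +
      (2 * \<rho> * s / (1 - \<rho>\<^sup>2)\<^sup>2) * (x * (z - z^3)) + (1 / (1 - \<rho>\<^sup>2)) * (x\<^sup>2 * z\<^sup>2)" for x z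
  proof -
    define v where "v = 1 - \<rho>\<^sup>2"
    have v: "v > 0" "s\<^sup>2 = v" using s by (simp_all add: v_def)
    have "score \<rho> (x, \<rho> * x + s * z) = (\<rho> * (1 - z\<^sup>2) + s * x * z) / v"
      unfolding score_def v_def[symmetric] using v
      by (simp add: power_mult_distrib) (simp add: field_simps power2_eq_square)
    then have "(score \<rho> (x, \<rho> * x + s * z))\<^sup>2 =
        (\<rho>\<^sup>2 * (1 - z\<^sup>2)\<^sup>2 + 2 * \<rho> * s * (x * (z * (1 - z\<^sup>2))) + s\<^sup>2 * (x\<^sup>2 * z\<^sup>2)) / v\<^sup>2"
      by (simp add: power_divide) (simp add: power2_eq_square algebra_simps)
    also have "\<dots> = \<rho>\<^sup>2 / v\<^sup>2 * (1 - z\<^sup>2)\<^sup>2 + 2 * \<rho> * s / v\<^sup>2 * (x * (z * (1 - z\<^sup>2))) +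
        v / v\<^sup>2 * (x\<^sup>2 * z\<^sup>2)"
      unfolding v(2) by (simp add: add_divide_distrib)
    also have "v / v\<^sup>2 = 1 / v" using v by (simp add: power2_eq_square)
    also have "(1 - z\<^sup>2)\<^sup>2 = 1 - 2 * z\<^sup>2 + z^4" by (simp add: power2_eq_square eval_nat_numeral algebra_simps)
    also have "z * (1 - z\<^sup>2) = z - z^3" by (simp add: power2_eq_square eval_nat_numeral algebra_simps)
    finally show ?thesis by (simp add: v_def)
  qed
  have "?F = (\<lambda>\<omega>. ?i \<omega> * (score \<rho> (X 1 \<omega>, Y 1 \<omega>))\<^sup>2)"
  proof
    fix \<omega>
    have "?i \<omega> * (score \<rho> (X 1 \<omega>, Y 1 \<omega>))\<^sup>2 = ?i \<omega> * (score \<rho> (X 1 \<omega>, \<rho> * X 1 \<omega> + s * Z 1 \<omega>))\<^sup>2"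
      by (simp add: noisy_copy_def)
    also have "\<dots> = ?F \<omega>" unfolding sc by (simp only: distrib_left mult_ac)
    finally show "?F \<omega> = ?i \<omega> * (score \<rho> (X 1 \<omega>, Y 1 \<omega>))\<^sup>2" by simp
  qed
  with * have "has_bochner_integral M (\<lambda>\<omega>. ?i \<omega> * (score \<rho> (X 1 \<omega>, Y 1 \<omega>))\<^sup>2) ?c" by simp
  then have "has_bochner_integral M (\<lambda>\<omega>. (score \<rho> (at_index X J \<omega>, at_index Y J \<omega>))\<^sup>2) (?c / Q t)"
    by (intro selected_moment[of "\<lambda>w. (score \<rho> w)\<^sup>2"])
      (simp_all add: score_def borel_prod[symmetric])
  also have "?c / Q t = 2 * \<rho>\<^sup>2 / (1 - \<rho>\<^sup>2)\<^sup>2 + (1 + t * hazard t) / (1 - \<rho>\<^sup>2)"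
    using Q_pos[of t] by (simp add: hazard_def add_divide_distrib mult_ac)
  finally show ?thesis .
qed

text \<open>The normal density conditioned on exceedance, times the transition density from
  \<open>X\<close> to its copy with correlation \<open>r\<close>.\<close>

definition cond_density :: "real \<Rightarrow> real \<times> real \<Rightarrow> real" where
  "cond_density r = (\<lambda>(x, y). indicator {t<..} x / Q t * std_normal_density x *
     normal_density (r * x) (sqrt (1 - r\<^sup>2)) y)"

text \<open>Independence across indices is given for the pairs at the true \<open>\<rho>\<close>. As
  \<open>s\<close> is nonzero, the noise is recovered as \<open>(y - \<rho> * x) / s\<close>, so the
  statistic at parameter \<open>r\<close> is the image of the selected true pair under the fixed map
  \<open>?g\<close>, and its law follows from \<open>F.nn_integral_W_J\<close>.\<close>

lemma distributed_selected:
  assumes rho1: "\<bar>\<rho>\<bar> < 1" and r: "r \<in> {-1<..<1}"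
  shows "distributed M lborel (\<lambda>\<omega>. (at_index X J \<omega>, at_index (noisy_copy X Z r) J \<omega>))
    (\<lambda>w. ennreal (cond_density r w))"
proof -
  let ?T = "\<lambda>\<omega>. (at_index X J \<omega>, at_index (noisy_copy X Z r) J \<omega>)"
  let ?c = "sqrt (1 - r\<^sup>2)"
  let ?g = "\<lambda>(x, y). (x, r * x + ?c * ((y - \<rho> * x) / s))"
  have s: "s \<noteq> 0" using rho1 by (simp add: abs_square_eq_1)
  have "0 < 1 - r\<^sup>2" using r by (simp add: abs_square_less_1 abs_less_iff)
  then have c: "0 < ?c" by simp
  have copy: "noisy_copy X Z r i \<omega> = snd (?g (W i \<omega>))" for i \<omega>
    using s by (simp add: noisy_copy_def)
  have T: "?T \<omega> = ?g (W (J \<omega>) \<omega>)" for \<omega>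
    by (simp add: at_index_def copy)
  have g[measurable]: "?g \<in> borel_measurable borel"
    unfolding borel_prod[symmetric] by measurable
  have T_meas: "?T \<in> borel_measurable M"
    unfolding T unfolding J_eq using measurable_compose[OF F.W_J_measurable g] by simp
  have d_meas[measurable]: "cond_density r \<in> borel_measurable borel"
  proof -
    have "(\<lambda>w. indicator {t<..} (fst w) / Q t * std_normal_density (fst w) *
        (1 / sqrt (2 * pi * (?c)\<^sup>2) * exp (- (snd w - r * fst w)\<^sup>2 / (2 * (?c)\<^sup>2)))) \<in>
        borel_measurable (borel \<Otimes>\<^sub>M borel)"
      by measurable
    then show ?thesis
      by (simp add: cond_density_def normal_density_def borel_prod split_beta')
  qed
  have joint: "distributed M (lborel \<Otimes>\<^sub>M lborel) (\<lambda>\<omega>. (X 1 \<omega>, Z 1 \<omega>))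
      (\<lambda>(x, z). ennreal (std_normal_density x) * ennreal (std_normal_density z))"
  proof (rule distributed_joint_indep)
    show "indep_var lborel (X 1) lborel (Z 1)"
      using XZ[OF order_refl] by (simp add: indep_var_eq)
  qed (use X Z in \<open>auto simp: lborel.sigma_finite_measure_axioms\<close>)
  have "distr M lborel ?T = density lborel (\<lambda>w. ennreal (cond_density r w))"
  proof (rule measure_eqI)
    fix A assume "A \<in> sets (distr M lborel ?T)"
    then have A[measurable]: "A \<in> sets borel" by simp
    have A'[measurable]: "A \<in> sets (borel \<Otimes>\<^sub>M borel)" using A unfolding borel_prod .
    have "emeasure (distr M lborel ?T) A = (\<integral>\<^sup>+w. indicator A w \<partial>distr M lborel ?T)"
      by simp
    also have "\<dots> = (\<integral>\<^sup>+\<omega>. indicator A (?T \<omega>) \<partial>M)"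
      using T_meas by (intro nn_integral_distr) auto
    also have "\<dots> = (\<integral>\<^sup>+\<omega>. ennreal (indicator B (W 1 \<omega>) / Q t) * indicator A (?g (W 1 \<omega>)) \<partial>M)"
      unfolding T unfolding J_eq by (rule F.nn_integral_W_J[of "\<lambda>w. indicator A (?g w)"]) measurable
    also have "\<dots> = (\<integral>\<^sup>+\<omega>. (\<lambda>(x, z). ennreal (indicator {t<..} x / Q t) *
        indicator A (x, r * x + ?c * z)) (X 1 \<omega>, Z 1 \<omega>) \<partial>M)"
      using s by (simp add: noisy_copy_def indicator_times)
    also have "\<dots> = (\<integral>\<^sup>+(x, z). (ennreal (std_normal_density x) * ennreal (std_normal_density z)) *
        (ennreal (indicator {t<..} x / Q t) * indicator A (x, r * x + ?c * z)) \<partial>(lborel \<Otimes>\<^sub>M lborel))"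
      by (subst distributed_nn_integral[OF joint, symmetric]) (simp_all add: case_prod_beta' borel_prod)
    also have "\<dots> = (\<integral>\<^sup>+x. \<integral>\<^sup>+z. (ennreal (std_normal_density x) * ennreal (std_normal_density z)) *
        (ennreal (indicator {t<..} x / Q t) * indicator A (x, r * x + ?c * z)) \<partial>lborel \<partial>lborel)"
      by (subst lborel.nn_integral_fst[symmetric]) auto
    also have "\<dots> = (\<integral>\<^sup>+x. \<integral>\<^sup>+y. ennreal (cond_density r (x, y)) * indicator A (x, y) \<partial>lborel \<partial>lborel)"
    proof (rule nn_integral_cong)
      fix x
      have [measurable]: "(\<lambda>y. cond_density r (x, y)) \<in> borel_measurable borel"
        unfolding cond_density_def by simp
      \<comment> \<open>The substitution \<open>y = r * x + ?c * z\<close> has Jacobian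
        \<open>?c\<close>, which turns the transition density into the standard normal density of
        the noise.\<close>
      have nd: "?c * normal_density (r * x) ?c (r * x + ?c * z) = std_normal_density z" for z
        using c by (rule normal_density_standardize)
      have "(\<integral>\<^sup>+y. ennreal (cond_density r (x, y)) * indicator A (x, y) \<partial>lborel) =
          (\<integral>\<^sup>+z. ennreal ?c * (ennreal (cond_density r (x, r * x + ?c * z)) *
             indicator A (x, r * x + ?c * z)) \<partial>lborel)"
        using c by (subst nn_integral_real_affine[of _ ?c "r * x"]) (auto simp: nn_integral_cmult)
      also have "\<dots> = (\<integral>\<^sup>+z. (ennreal (std_normal_density x) * ennreal (std_normal_density z)) *
        (ennreal (indicator {t<..} x / Q t) * indicator A (x, r * x + ?c * z)) \<partial>lborel)"
      proof (rule nn_integral_cong)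
        fix z
        have "ennreal ?c * ennreal (cond_density r (x, r * x + ?c * z)) =
            ennreal (indicator {t<..} x / Q t * std_normal_density x *
              (?c * normal_density (r * x) ?c (r * x + ?c * z)))"
          using c by (subst ennreal_mult''[symmetric])
            (auto simp: cond_density_def Q_nonneg mult_ac)
        also have "\<dots> = ennreal (std_normal_density x) * ennreal (std_normal_density z) *
            ennreal (indicator {t<..} x / Q t)"
          unfolding nd by (simp add: ennreal_mult[symmetric] Q_nonneg mult_ac)
        finally show "ennreal ?c * (ennreal (cond_density r (x, r * x + ?c * z)) *
             indicator A (x, r * x + ?c * z)) =
            (ennreal (std_normal_density x) * ennreal (std_normal_density z)) *
            (ennreal (indicator {t<..} x / Q t) * indicator A (x, r * x + ?c * z))"
          by (simp add: mult.assoc[symmetric])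
      qed
      finally show "(\<integral>\<^sup>+z. (ennreal (std_normal_density x) * ennreal (std_normal_density z)) *
        (ennreal (indicator {t<..} x / Q t) * indicator A (x, r * x + ?c * z)) \<partial>lborel) =
        (\<integral>\<^sup>+y. ennreal (cond_density r (x, y)) * indicator A (x, y) \<partial>lborel)" by simp
    qed
    also have "\<dots> = (\<integral>\<^sup>+w. ennreal (cond_density r w) * indicator A w \<partial>(lborel \<Otimes>\<^sub>M lborel))"
      by (subst lborel.nn_integral_fst[symmetric]) (auto simp: lborel_prod)
    also have "\<dots> = emeasure (density lborel (\<lambda>w. ennreal (cond_density r w))) A"
      by (subst emeasure_density) (auto simp: lborel_prod)
    finally show "emeasure (distr M lborel ?T) A = emeasure (density lborel (\<lambda>w. ennreal (cond_density r w))) A" .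
  qed simp
  then show ?thesis
    unfolding distributed_def using T_meas d_meas by simp
qed

text \<open>The parameter enters \<open>cond_density\<close> through the transition factor only, so
  where the density is positive its logarithmic derivative is \<open>score\<close>, and the integral
  is the expectation already computed.\<close>

lemma has_fisher_information_selected:
  assumes rho1: "\<bar>\<rho>\<bar> < 1"
  shows "has_fisher_information M lborel {-1<..<1}
    (\<lambda>r \<omega>. (at_index X J \<omega>, at_index (noisy_copy X Z r) J \<omega>)) \<rho>
    (2 * \<rho>\<^sup>2 / (1 - \<rho>\<^sup>2)\<^sup>2 + (1 + t * hazard t) / (1 - \<rho>\<^sup>2))"
  unfolding has_fisher_information_def smooth_densities_def
proof (intro exI[of _ cond_density] conjI ballI allI)
  have rho_mem: "\<rho> \<in> {-1<..<1}" using rho1 by auto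
  have nonneg: "0 \<le> cond_density r w" for r w
    by (simp add: cond_density_def Q_nonneg split: prod.split)
  then show "0 \<le> cond_density r w" for r w .
  show "distributed M lborel (\<lambda>\<omega>. (at_index X J \<omega>, at_index (noisy_copy X Z r) J \<omega>))
      (\<lambda>w. ennreal (cond_density r w))" if "r \<in> {-1<..<1}" for r
    by (rule distributed_selected[OF rho1 that])
  show "(\<lambda>r. cond_density r w) differentiable_on {-1<..<1}" for w
    unfolding cond_density_def case_prod_beta'
    by (intro differentiable_on_mult differentiable_on_const normal_density_differentiable)
  have "has_bochner_integral lborel (\<lambda>w. cond_density \<rho> w * (score \<rho> w)\<^sup>2)
      (2 * \<rho>\<^sup>2 / (1 - \<rho>\<^sup>2)\<^sup>2 + (1 + t * hazard t) / (1 - \<rho>\<^sup>2))"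
    by (rule distributed_has_bochner_integral[OF distributed_selected[OF rho1 rho_mem] nonneg
        _ expectation_score_squared[OF rho1]])
      (simp add: score_def borel_prod[symmetric])
  moreover have "cond_density \<rho> w * (deriv (\<lambda>r. ln (cond_density r w)) \<rho>)\<^sup>2 =
      cond_density \<rho> w * (score \<rho> w)\<^sup>2" for w
  proof (cases "fst w > t")
    case True
    define c where "c = std_normal_density (fst w) / Q t"
    have c: "c > 0" by (simp add: c_def Q_pos normal_density_pos)
    have "((\<lambda>r. ln c + ln (normal_density (r * fst w) (sqrt (1 - r\<^sup>2)) (snd w))) has_real_derivative
        0 + score \<rho> w) (at \<rho>)"
      unfolding score_def case_prod_beta'
      by (intro DERIV_add DERIV_const normal_log_density_deriv rho_mem)
    then have "((\<lambda>r. ln (cond_density r w)) has_real_derivative 0 + score \<rho> w) (at \<rho>)"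
    proof (rule has_field_derivative_transform_within_open[where S="{-1<..<1}"])
      fix r :: real assume "r \<in> {-1<..<1}"
      then have "0 < normal_density (r * fst w) (sqrt (1 - r\<^sup>2)) (snd w)"
        by (intro normal_density_pos) (simp add: abs_square_less_1 abs_less_iff)
      moreover have "cond_density r w = c * normal_density (r * fst w) (sqrt (1 - r\<^sup>2)) (snd w)"
        using True by (cases w) (simp add: cond_density_def c_def)
      ultimately show "ln c + ln (normal_density (r * fst w) (sqrt (1 - r\<^sup>2)) (snd w)) =
          ln (cond_density r w)"
        using c by (simp add: ln_mult)
    qed (use rho_mem in auto)
    then show ?thesis by (simp add: DERIV_imp_deriv)
  \<comment> \<open>Outside the half plane the density is 0 and both sides vanish, whatever
    \<open>deriv\<close> returns there.\<close>
  qed (cases w, simp add: cond_density_def)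
  ultimately show "has_bochner_integral lborel
      (\<lambda>w. cond_density \<rho> w * (deriv (\<lambda>r. ln (cond_density r w)) \<rho>)\<^sup>2)
      (2 * \<rho>\<^sup>2 / (1 - \<rho>\<^sup>2)\<^sup>2 + (1 + t * hazard t) / (1 - \<rho>\<^sup>2))"
    by (simp only:)
qed

section \<open>Mean and variance of the estimator\<close>

definition selected_estimator :: "'a \<Rightarrow> real" where
  "selected_estimator \<omega> = at_index Y J \<omega> / hazard t"

lemma selected_estimator_mean: "has_bochner_integral M selected_estimator \<rho>"
  using has_bochner_integral_divide_zero[of "hazard t", OF expectation_Y_J] hazard_pos[of t]
  by (simp add: selected_estimator_def[abs_def])

lemma selected_estimator_second_moment:
  "has_bochner_integral M (\<lambda>\<omega>. (selected_estimator \<omega>)\<^sup>2) ((1 + \<rho>\<^sup>2 * t * hazard t) / (hazard t)\<^sup>2)"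
  using has_bochner_integral_divide_zero[of "(hazard t)\<^sup>2", OF expectation_Y_J_squared]
  by (simp add: selected_estimator_def[abs_def] power_divide)

text \<open>The numerator is the law of total variance for the selected \<open>Y\<close>:
  \<open>1 - \<rho>^2\<close> from the noise and \<open>\<rho>^2 * tail_variance t\<close> from the
  spread of the selected \<open>X\<close>.\<close>

lemma selected_estimator_variance:
  "variance selected_estimator = (1 - \<rho>\<^sup>2 + \<rho>\<^sup>2 * tail_variance t) / (hazard t)\<^sup>2"
proof -
  have "variance selected_estimator = (1 + \<rho>\<^sup>2 * t * hazard t) / (hazard t)\<^sup>2 - \<rho>\<^sup>2"
    using selected_estimator_mean selected_estimator_second_moment
    by (subst variance_eq) (auto simp: has_bochner_integral_iff)
  also have "\<dots> = (1 - \<rho>\<^sup>2 + \<rho>\<^sup>2 * tail_variance t) / (hazard t)\<^sup>2"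
    using hazard_pos[of t] by (simp add: tail_variance_def field_simps)
  finally show ?thesis .
qed

end

section \<open>Variance asymptotics and efficiency as the rate grows\<close>

theorem theorem2:
  fixes M :: "'a measure" and X Z :: "nat \<Rightarrow> 'a \<Rightarrow> real" and \<rho> :: real
  assumes "prob_space M"
    and "\<rho> \<in> {-1..1}"
    and "\<forall>i\<ge>1. distributed M lborel (X i) std_normal_density"
    and "\<forall>i\<ge>1. distributed M lborel (Z i) std_normal_density"
    and "\<forall>i\<ge>1. prob_space.indep_var M borel (X i) borel (Z i)"
    and "prob_space.indep_vars M (\<lambda>_. borel) (\<lambda>i \<omega>. (X i \<omega>, noisy_copy X Z \<rho> i \<omega>)) {1..}"
  defines "J \<equiv> \<lambda>k. first_exceedance X (threshold k)"
    and "est \<equiv> threshold_estimator M X (noisy_copy X Z \<rho>)"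
  shows "(\<forall>k>0. prob_space.entropy M 2 (count_space UNIV) (J k) = k) \<and>
    (\<forall>k>0. integrable M (est k) \<and> prob_space.expectation M (est k) = \<rho>) \<and>
    (\<forall>k>0. integrable M (\<lambda>\<omega>. (est k \<omega>)\<^sup>2)) \<and>
    (\<exists>e \<in> o[at_top](\<lambda>_. 1). \<forall>k>0.
        prob_space.variance M (est k) = 1 / k * ((1 - \<rho>\<^sup>2) / (2 * ln 2) + e k)) \<and>
    (\<bar>\<rho>\<bar> < 1 \<longrightarrow>
        asymptotically_efficient M lborel {-1<..<1}
          (\<lambda>k r \<omega>. (at_index X (J k) \<omega>, at_index (noisy_copy X Z r) (J k) \<omega>)) est \<rho>)"
proof -
  interpret prob_space M by fact
  have TP: "thresholded_pairs M X Z \<rho>"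
    using assms(2-6) by unfold_locales auto
  \<comment> \<open>The locale assumptions do not mention \<open>t\<close>, so one interpretation
    covers all thresholds and is instantiated at \<open>threshold k\<close> for each rate.\<close>
  interpret T: thresholded_pairs M X Z \<rho> t for t by (rule TP)
  let ?h = "\<lambda>k. hazard (threshold k)" and ?v = "\<lambda>k. tail_variance (threshold k)"
  have est: "est k = T.selected_estimator (threshold k)" for k
    using has_bochner_integral_integral_eq[OF T.expectation_X_J[of "threshold k"]]
    by (simp add: fun_eq_iff est_def threshold_estimator_def T.selected_estimator_def Let_def)
  have var: "variance (est k) = (1 - \<rho>\<^sup>2 + \<rho>\<^sup>2 * ?v k) / (?h k)\<^sup>2" for k
    unfolding est by (rule T.selected_estimator_variance)
  have mean: "integrable M (est k)" "expectation (est k) = \<rho>" for k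
    using T.selected_estimator_mean[of "threshold k"] by (auto simp: est has_bochner_integral_iff)
  have sq: "integrable M (\<lambda>\<omega>. (est k \<omega>)\<^sup>2)" for k
    using T.selected_estimator_second_moment[of "threshold k"]
    by (auto simp: est has_bochner_integral_iff)
  have entropy: "entropy 2 (count_space UNIV) (J k) = k" if "k > 0" for k
    unfolding J_def T.J_eq T.F.entropy_J[OF threshold_props(1)[OF that]]
    by (rule threshold_props(2)[OF that])
  have v0: "(?v \<longlongrightarrow> 0) at_top"
    by (rule filterlim_compose[OF tail_variance_tendsto threshold_at_top])
  have h_inf: "filterlim ?h at_top at_top"
    by (rule filterlim_compose[OF hazard_at_top threshold_at_top])
  then have h2: "filterlim (\<lambda>k. (?h k)\<^sup>2) at_infinity at_top"
    by (intro filterlim_at_top_imp_at_infinity filterlim_pow_at_top) auto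
  have kh: "((\<lambda>k. geometric_entropy (Q (threshold k)) / (?h k)\<^sup>2) \<longlongrightarrow> 1 / (2 * ln 2)) at_top"
    by (rule filterlim_compose[OF geometric_entropy_Q_asymp threshold_at_top])
  \<comment> \<open>For positive \<open>k\<close> the entropy factor is \<open>k\<close> itself;
    written through the threshold, its limit can be pulled back along
    \<open>threshold_at_top\<close>.\<close>
  have "((\<lambda>k. geometric_entropy (Q (threshold k)) / (?h k)\<^sup>2 * (1 - \<rho>\<^sup>2 + \<rho>\<^sup>2 * ?v k)) \<longlongrightarrow>
      1 / (2 * ln 2) * (1 - \<rho>\<^sup>2 + \<rho>\<^sup>2 * 0)) at_top"
    by (intro tendsto_intros kh v0)
  moreover have "eventually (\<lambda>k. geometric_entropy (Q (threshold k)) / (?h k)\<^sup>2 *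
      (1 - \<rho>\<^sup>2 + \<rho>\<^sup>2 * ?v k) = k * variance (est k)) at_top"
    using eventually_gt_at_top[of 0] by eventually_elim (simp add: threshold_props var)
  ultimately have kvar: "((\<lambda>k. k * variance (est k)) \<longlongrightarrow> (1 - \<rho>\<^sup>2) / (2 * ln 2)) at_top"
    by (simp cong: filterlim_cong add: filterlim_cong)
  \<comment> \<open>The exact remainder: the variance formula becomes an identity for every positive
    \<open>k\<close>, and only the smallness of \<open>e\<close> is asymptotic.\<close>
  define e where "e k = k * variance (est k) - (1 - \<rho>\<^sup>2) / (2 * ln 2)" for k
  have "(e \<longlongrightarrow> 0) at_top"
    unfolding e_def[abs_def] using kvar by (simp add: LIM_zero)
  then have e: "e \<in> o[at_top](\<lambda>_. 1)" by (intro smalloI_tendsto) auto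
  have e_var: "variance (est k) = 1 / k * ((1 - \<rho>\<^sup>2) / (2 * ln 2) + e k)" if "k > 0" for k
    using that by (simp add: e_def)
  have efficient: "asymptotically_efficient M lborel {-1<..<1}
      (\<lambda>k r \<omega>. (at_index X (J k) \<omega>, at_index (noisy_copy X Z r) (J k) \<omega>)) est \<rho>"
    if rho1: "\<bar>\<rho>\<bar> < 1"
    unfolding asymptotically_efficient_def
  proof (intro conjI exI allI impI)
    let ?I = "\<lambda>k. 2 * \<rho>\<^sup>2 / (1 - \<rho>\<^sup>2)\<^sup>2 + (1 + threshold k * ?h k) / (1 - \<rho>\<^sup>2)"
    show "((\<lambda>k. expectation (est k)) \<longlongrightarrow> \<rho>) at_top" by (simp add: mean)
    show "has_fisher_information M lborel {-1<..<1}
        (\<lambda>r \<omega>. (at_index X (J k) \<omega>, at_index (noisy_copy X Z r) (J k) \<omega>)) \<rho> (?I k)" for k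
      unfolding J_def by (rule T.has_fisher_information_selected[OF rho1])
    have s: "0 < 1 - \<rho>\<^sup>2" using rho1 by (simp add: abs_square_less_1)
    \<comment> \<open>The factor \<open>1 / (?h k)^2\<close> of the variance is moved into the
      information. Every \<open>?h k\<close> then stands in a denominator, the limit can be taken
      termwise, and the surviving factors \<open>1 / (1 - \<rho>^2)\<close> and
      \<open>1 - \<rho>^2\<close> cancel.\<close>
    have I_var: "(2 * \<rho>\<^sup>2 / (1 - \<rho>\<^sup>2)\<^sup>2 / (?h k)\<^sup>2 + (1 + ?v k / (?h k)\<^sup>2) / (1 - \<rho>\<^sup>2)) *
        (1 - \<rho>\<^sup>2 + \<rho>\<^sup>2 * ?v k) = ?I k * variance (est k)" for k
    proof -
      have "1 + threshold k * ?h k = ?v k + (?h k)\<^sup>2" by (simp add: tail_variance_def)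
      then have "?I k / (?h k)\<^sup>2 = 2 * \<rho>\<^sup>2 / (1 - \<rho>\<^sup>2)\<^sup>2 / (?h k)\<^sup>2 +
          (?v k + (?h k)\<^sup>2) / (?h k)\<^sup>2 / (1 - \<rho>\<^sup>2)"
        by (simp add: add_divide_distrib mult.commute)
      also have "(?v k + (?h k)\<^sup>2) / (?h k)\<^sup>2 = 1 + ?v k / (?h k)\<^sup>2"
        using hazard_pos[of "threshold k"] by (simp add: add_divide_distrib)
      finally have *: "?I k / (?h k)\<^sup>2 = 2 * \<rho>\<^sup>2 / (1 - \<rho>\<^sup>2)\<^sup>2 / (?h k)\<^sup>2 +
          (1 + ?v k / (?h k)\<^sup>2) / (1 - \<rho>\<^sup>2)" .
      show ?thesis unfolding var *[symmetric] by simp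
    qed
    have "((\<lambda>k. (2 * \<rho>\<^sup>2 / (1 - \<rho>\<^sup>2)\<^sup>2 / (?h k)\<^sup>2 + (1 + ?v k / (?h k)\<^sup>2) / (1 - \<rho>\<^sup>2)) *
        (1 - \<rho>\<^sup>2 + \<rho>\<^sup>2 * ?v k)) \<longlongrightarrow> (0 + (1 + 0) / (1 - \<rho>\<^sup>2)) * (1 - \<rho>\<^sup>2 + \<rho>\<^sup>2 * 0)) at_top"
      by (intro tendsto_mult tendsto_add tendsto_divide tendsto_const v0
          tendsto_divide_0[OF tendsto_const h2] tendsto_divide_0[OF v0 h2]) (use s in auto)
    then show "((\<lambda>k. ?I k * variance (est k)) \<longlongrightarrow> 1) at_top"
      unfolding I_var using s by simp
  qed
  show ?thesis
    using entropy mean sq e e_var efficient by blast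
qed

end
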